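(* (i) Let $S\equiv\pm\{1, 5, 9, 12, 13, 14, 16, 23, 27, 31, 34, 35\}\pmod{72}$ and $T\equiv\pm\{1, 4, 9, 11, 13, 14, 23, 25, 27, 30, 32, 35\}\pmod{72}$. Then $p(S,n)=p(T,n-1)$ for all $n\geq 1$. (ii) Let $S\equiv\pm\{2, 5, 6, 7, 9, 16, 17, 19, 20, 27, 29, 31\}\pmod{72}$ and $T\equiv\pm\{2, 5, 7, 8, 9, 11, 12, 25, 26, 27, 29, 31\}\pmod{72}$. Then $p(S,n)=p(T,n)$ for all integers $n\ge0$ with $n\neq 6$. (iii) Let $S\equiv\pm\{5, 6, 7, 8, 9, 17, 19, 26, 27, 28, 29, 31\}\pmod{72}$ and $T\equiv\pm\{1, 7, 9, 12, 17, 19, 22, 26, 27, 29, 32, 35\}\pmod{72}$. Then $p(S,n)=p(T,n-5)$ for all $n\geq 5$. (iv) Let $S\equiv\pm\{1, 9, 10, 11, 12, 14, 17, 19, 25, 27, 32, 35\}\pmod{72}$ and $T\equiv\pm\{1, 8, 9, 10, 11, 13, 23, 25, 27, 28, 30, 35\}\pmod{72}$. Then $p(S,n)=p(T,n-1)$ for all $n\geq 1$. (v) Let $S\equiv\pm\{7, 8, 9, 10, 11, 12, 13, 23, 25, 27, 29, 34\}\pmod{72}$ and $T\equiv\pm\{1, 9, 11, 13, 16, 20, 23, 25, 27, 30, 34, 35\}\pmod{72}$. Then $p(S,n)=p(T,n-7)$ for all $n\geq 7$. (vi) Let $S\equiv\pm\{4, 5, 6, 7, 9, 17, 19, 22, 27,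 29, 31, 32\}\pmod{72}$ and $T\equiv\pm\{2, 5, 9, 12, 13, 16, 17, 19, 22, 23, 27, 31\}\pmod{72}$. Then $p(S,n)=p(T,n)$ for all integers $n\ge0$ with $n\neq 2$.
   Context: For a set $S$ of positive integers and an integer $n\ge 0$, $p(S,n)$ denotes the number of partitions of $n$ into parts belonging to $S$ (so $p(S,0)=1$). The notation $S\equiv\pm\{r_1,\dots,r_k\}\pmod M$ means that $S$ is the set of all positive integers $n$ such that $n\equiv r_i$ or $n\equiv -r_i\pmod M$ for some $i$. *)

theory Defs
  imports "HOL-Library.Multiset" "HOL-Number_Theory.Cong"
begin

definition partitions_into :: "nat set \<Rightarrow> nat \<Rightarrow> nat multiset set" where
  "partitions_into S n = {P. set_mset P \<subseteq> S \<and> sum_mset P = n}"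

text \<open>Meant for sets \<open>S\<close> of positive integers only: for \<open>0 \<in> S\<close> the set counted is
  infinite or empty, so the value is always 0.\<close>

definition num_partitions :: "nat set \<Rightarrow> nat \<Rightarrow> nat" where
  "num_partitions S n = card (partitions_into S n)"

text \<open>The set of positive integers \<open>S \<equiv> \<plusminus>R (mod M)\<close>.\<close>

definition pm_residues :: "int set \<Rightarrow> int \<Rightarrow> nat set" where
  "pm_residues R M = {n. n > 0 \<and> (\<exists>r\<in>R. [int n = r] (mod M) \<or> [int n = - r] (mod M))}"

lemma finite_partitions_into:
  assumes "0 \<notin> S"
  shows "finite (partitions_into S n)"
proof -
  have size: "size P \<le> sum_mset P" if "0 \<notin># P" for P :: "nat multiset"
    using that by (induction P) auto
  have "partitions_into S n \<subseteq> mset ` {xs. set xs \<subseteq> {..n} \<and> length xs \<le> n}"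
  proof
    fix P assume "P \<in> partitions_into S n"
    then have P: "set_mset P \<subseteq> S" "sum_mset P = n"
      by (auto simp: partitions_into_def)
    obtain xs where xs: "P = mset xs"
      by (metis ex_mset)
    have "x \<le> n" if "x \<in># P" for x
      using that P(2) by (metis le_add1 multi_member_split sum_mset.add_mset)
    moreover have "size P \<le> n"
      using size[of P] P assms by auto
    ultimately show "P \<in> mset ` {xs. set xs \<subseteq> {..n} \<and> length xs \<le> n}"
      using xs by auto
  qed
  then show ?thesis
    by (rule finite_subset) (simp add: finite_lists_length_le)
qed

lemma num_partitions_0:
  assumes "0 \<notin> S"
  shows "num_partitions S 0 = 1"
proof -
  have "P = {#}" if "set_mset P \<subseteq> S" "sum_mset P = 0" for P
  proof (rule ccontr)
    assume "P \<noteq> {#}"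
    then obtain x where "x \<in># P" by blast
    then show False using that assms by auto
  qed
  then have "partitions_into S 0 = {{#}}"
    by (auto simp: partitions_into_def)
  then show ?thesis by (simp add: num_partitions_def)
qed

lemma zero_notin_pm_residues: "0 \<notin> pm_residues R M"
  by (simp add: pm_residues_def)

end

theory Submission
  imports "HOL-Analysis.Analysis" "HOL-Library.Nat_Bijection" Defs
begin

text \<open>
  Write \<open>[a]\<close> for the product of all \<open>(1 - q^n)\<close> over positive \<open>n \<equiv> \<plusminus>a (mod 72)\<close>. The generating function
  of \<open>p(S, n)\<close> is the reciprocal of the product of the \<open>[s]\<close>, so each claim says that the difference
  of two such reciprocals (one of them shifted) is a single monomial in \<open>q\<close>. After normalising \<open>[a]\<close> by a
  power of \<open>q\<close>, it becomes an odd function of \<open>a\<close> that changes sign under \<open>a \<mapsto> a + 72\<close>, and the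
  six claims become the instances \<open>k = 1, 5, 7, 11, 13, 17\<close> of one identity in the functions
  \<open>a \<mapsto> [k a]\<close>. That identity is a linear combination of three instances of
  the three-term Weierstrass relation for the theta function of nome \<open>q^36\<close> at points \<open>\<plusminus>q^(k a)\<close>, since
  \<open>\<theta>(q^a; q^36) = [a] [36 - a]\<close> and \<open>\<theta>(q^a; q^36) \<theta>(-q^a; q^36) = [2 a]\<close>. The Weierstrass relation
  itself is the Pluecker relation for 2 x 2 minors, because \<open>y \<theta>(x y) \<theta>(x / y)\<close> is of the form
  \<open>y \<phi>(x) \<psi>(y) - x \<phi>(y) \<psi>(x)\<close> by the Jacobi triple product.
\<close>

subsection \<open>The Jacobi triple product\<close>

text \<open>The q-Pochhammer symbol (p; p)_n.\<close>

definition qfac :: "real \<Rightarrow> nat \<Rightarrow> real" where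
  "qfac p n = (\<Prod>k<n. 1 - p ^ Suc k)"

text \<open>The Gaussian binomial coefficient. The value 0 for \<open>j > n\<close> lets Pascal's
  rule hold for every \<open>j\<close>.\<close>

definition qbinom :: "real \<Rightarrow> nat \<Rightarrow> nat \<Rightarrow> real" where
  "qbinom p n j = (if j \<le> n then qfac p n / (qfac p j * qfac p (n - j)) else 0)"

text \<open>(x; p)_inf (p/x; p)_inf, that is, the theta function without its constant factor (p;
  p)_inf.\<close>

definition theta :: "real \<Rightarrow> real \<Rightarrow> real" where
  "theta x p = (\<Prod>k. (1 - x * p ^ k) * (1 - p ^ Suc k / x))"

definition theta_series :: "real \<Rightarrow> real \<Rightarrow> real" where
  "theta_series z r = (\<Sum>\<^sub>\<infinity>n::int. z powi n * r ^ nat (n\<^sup>2))"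

lemma qfac_pos:
  assumes "0 < p" "p < 1"
  shows "qfac p n > 0"
  unfolding qfac_def using assms by (intro prod_pos) (simp add: power_less_one_iff del: power_Suc)

lemma qfac_Suc: "qfac p (Suc n) = qfac p n * (1 - p ^ Suc n)"
  by (simp add: qfac_def)

lemma qbinom_0: "0 < p \<Longrightarrow> p < 1 \<Longrightarrow> qbinom p n 0 = 1"
  using qfac_pos[of p n] qfac_pos[of p 0] by (simp add: qbinom_def) (simp add: qfac_def)

text \<open>Pascal's rule multiplied by \<open>p ^ j\<close>: its usual factor p^(n - j) becomes
  \<open>p ^ n\<close>, which avoids truncated subtraction.\<close>

lemma qbinom_Suc_Suc:
  assumes "0 < p" "p < 1"
  shows "qbinom p (Suc n) (Suc j) * p ^ j = qbinom p n (Suc j) * p ^ j + p ^ n * qbinom p n j"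
proof -
  consider "j < n" | "j = n" | "j > n" by linarith
  then show ?thesis
  proof cases
    case 1
    then obtain d where n: "n = Suc (j + d)" using less_imp_Suc_add by blast
    have nz: "qfac p m \<noteq> 0" for m using qfac_pos[OF assms, of m] by simp
    have lt: "1 - p ^ Suc j \<noteq> 0" "1 - p ^ Suc d \<noteq> 0"
      using power_Suc_less_one[of p] assms by (smt (verit))+
    have d: "qfac p (Suc n) = qfac p n * (1 - p ^ Suc n)"
        "qfac p (Suc j) = qfac p j * (1 - p ^ Suc j)" "qfac p (Suc d) = qfac p d * (1 - p ^ Suc d)"
      by (rule qfac_Suc)+
    have b: "qbinom p (Suc n) (Suc j) = qfac p (Suc n) / (qfac p (Suc j) * qfac p (Suc d))"
       "qbinom p n (Suc j) = qfac p n / (qfac p (Suc j) * qfac p d)"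
       "qbinom p n j = qfac p n / (qfac p j * qfac p (Suc d))"
      by (auto simp: qbinom_def n)
    have e: "p ^ n = p ^ j * p ^ Suc d" "p ^ Suc n = p ^ Suc j * p ^ Suc d"
      by (simp_all add: n power_add)
    define A where "A = p ^ Suc j"
    define B where "B = p ^ Suc d"
    have cancel: "x / (a * (1 - A) * c) + B * (x / (a * (c * (1 - B)))) = x * (1 - A * B) / (a * (1 - A) * (c * (1 - B)))"
      if "a \<noteq> 0" "c \<noteq> 0" "1 - A \<noteq> 0" "1 - B \<noteq> 0" for a c x :: real
      using that by (simp add: divide_simps) (simp add: algebra_simps)
    \<comment> \<open>Pascal's rule in its usual form, since \<open>B\<close> is p^(n - j).\<close>
    have "qbinom p n (Suc j) + B * qbinom p n j = qbinom p (Suc n) (Suc j)"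
      unfolding b d e(2) A_def[symmetric] B_def[symmetric]
      by (rule cancel) (use nz lt[folded A_def B_def] in auto)
    then have "p ^ j * qbinom p (Suc n) (Suc j) = p ^ j * (qbinom p n (Suc j) + B * qbinom p n j)" by simp
    then show ?thesis unfolding e(1) B_def by (simp add: algebra_simps)
  next
    case 2
    then show ?thesis using qfac_pos[OF assms, of n] qfac_pos[OF assms, of "Suc n"]
      by (simp add: qbinom_def)
  next
    case 3
    then show ?thesis by (simp add: qbinom_def)
  qed
qed

text \<open>Induction by Pascal's rule. The ratio \<open>p ^ j\<close> of consecutive triangular
  powers \<open>?c\<close> is exactly the factor carried along in
  \<open>qbinom_Suc_Suc\<close>.\<close>

lemma qbinomial_theorem:
  assumes "0 < p" "p < 1"
  shows "(\<Prod>k<n. 1 + z * p ^ k) = (\<Sum>j\<le>n. p ^ (j * (j - 1) div 2) * qbinom p n j * z ^ j)"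
proof (induction n)
  case 0
  then show ?case using assms by (simp add: qbinom_0)
next
  case (Suc n)
  let ?c = "\<lambda>j. p ^ (j * (j - 1) div 2)"
  have tri: "?c (Suc j) = ?c j * p ^ j" for j
  proof -
    have "Suc j * (Suc j - 1) = j * (j - 1) + j * 2" by (cases j) (auto simp: algebra_simps)
    then have "Suc j * (Suc j - 1) div 2 = j * (j - 1) div 2 + j" by simp
    then show ?thesis by (simp add: power_add)
  qed
  have rec: "?c (Suc j) * qbinom p (Suc n) (Suc j) * z ^ Suc j
      = ?c (Suc j) * qbinom p n (Suc j) * z ^ Suc j + (z * p ^ n) * (?c j * qbinom p n j * z ^ j)" for j
  proof -
    have "?c (Suc j) * qbinom p (Suc n) (Suc j) * z ^ Suc j = ?c j * z ^ Suc j * (qbinom p (Suc n) (Suc j) * p ^ j)"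
      unfolding tri by simp
    also have "\<dots> = ?c j * z ^ Suc j * (qbinom p n (Suc j) * p ^ j + p ^ n * qbinom p n j)"
      by (simp only: qbinom_Suc_Suc[OF assms])
    finally show ?thesis unfolding tri by (simp add: algebra_simps)
  qed
  have "(\<Prod>k<Suc n. 1 + z * p ^ k) = (\<Sum>j\<le>n. ?c j * qbinom p n j * z ^ j) * (1 + z * p ^ n)"
    by (simp only: prod.lessThan_Suc Suc)
  also have "\<dots> = (\<Sum>j\<le>n. ?c j * qbinom p n j * z ^ j) + (\<Sum>j\<le>n. (z * p ^ n) * (?c j * qbinom p n j * z ^ j))"
    by (simp only: sum_distrib_left distrib_left mult_1_right mult.commute[of _ "z * p ^ n"])
  also have "(\<Sum>j\<le>n. ?c j * qbinom p n j * z ^ j) = (\<Sum>j\<le>Suc n. ?c j * qbinom p n j * z ^ j)"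
    by (simp add: qbinom_def)
  also have "\<dots> = 1 + (\<Sum>j\<le>n. ?c (Suc j) * qbinom p n (Suc j) * z ^ Suc j)"
    by (subst sum.atMost_Suc_shift) (simp add: qbinom_0 assms)
  also have "\<dots> + (\<Sum>j\<le>n. (z * p ^ n) * (?c j * qbinom p n j * z ^ j))
      = 1 + (\<Sum>j\<le>n. ?c (Suc j) * qbinom p (Suc n) (Suc j) * z ^ Suc j)"
    by (simp only: rec sum.distrib add.assoc)
  also have "\<dots> = (\<Sum>j\<le>Suc n. ?c j * qbinom p (Suc n) j * z ^ j)"
    by (subst sum.atMost_Suc_shift) (simp add: qbinom_0 assms)
  finally show ?case .
qed

lemma prod_lessThan_add:
  fixes f :: "nat \<Rightarrow> 'a :: comm_monoid_mult"
  shows "(\<Prod>k<m + n. f k) = (\<Prod>k<m. f k) * (\<Prod>k<n. f (m + k))"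
  by (induction n) (simp_all add: mult.assoc)

text \<open>Cauchy's finite form: the q-binomial theorem of base r^2 with 2N factors, its argument
  \<open>w\<close> scaled so that the exponents of \<open>r\<close> run through the odd numbers from
  1 - 2N to 2N - 1. Pulling a monomial out of each factor with a negative exponent produces the
  factors containing 1/z.\<close>

lemma finite_jacobi_triple_product:
  fixes r z :: real
  assumes r: "0 < r" "r < 1" and z: "z \<noteq> 0"
  shows "(\<Prod>k<N. (1 + z * r ^ (2 * k + 1)) * (1 + r ^ (2 * k + 1) / z))
       = (\<Sum>n\<in>{- int N..int N}. z powi n * r ^ nat (n\<^sup>2) * qbinom (r\<^sup>2) (2 * N) (nat (int N + n)))"
proof -
  have p: "0 < r\<^sup>2" "r\<^sup>2 < 1" using r by (auto simp: power_less_one_iff)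
  define w where "w = z * r powi (1 - 2 * int N)"
  have w: "w * (r\<^sup>2) ^ k = z * r powi (2 * int k + 1 - 2 * int N)" for k
  proof -
    have "(r\<^sup>2) ^ k = r powi (int (2 * k))"
      by (simp only: power_int_of_nat power_mult)
    then show ?thesis using r by (simp add: w_def power_int_add[symmetric] algebra_simps)
  qed
  have "(\<Prod>k<2*N. 1 + w * (r\<^sup>2) ^ k) = (\<Prod>k<N. 1 + w * (r\<^sup>2) ^ k) * (\<Prod>k<N. 1 + w * (r\<^sup>2) ^ (N + k))"
    by (simp only: mult_2 prod_lessThan_add)
  also have "(\<Prod>k<N. 1 + w * (r\<^sup>2) ^ k) = (\<Prod>k<N. 1 + w * (r\<^sup>2) ^ (N - Suc k))"
    by (rule prod.nat_diff_reindex[symmetric])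
  also have "\<dots> = (\<Prod>k<N. (z * r powi (- (2 * int k + 1))) * (1 + r ^ (2 * k + 1) / z))"
  proof (rule prod.cong)
    fix k assume "k \<in> {..<N}"
    then have "2 * int (N - Suc k) + 1 - 2 * int N = - (2 * int k + 1)" by auto
    then have "w * (r\<^sup>2) ^ (N - Suc k) = z * r powi (- (2 * int k + 1))" by (simp only: w)
    moreover have "r powi (- (2 * int k + 1)) * r ^ (2 * k + 1) = 1"
    proof -
      have "r ^ (2 * k + 1) = r powi (int (2 * k + 1))"
        by (simp only: power_int_of_nat)
      also have "int (2 * k + 1) = 2 * int k + 1" by simp
      finally show ?thesis
        using r by (metis left_inverse less_irrefl power_int_minus power_int_eq_0_iff)
    qed
    ultimately show "1 + w * (r\<^sup>2) ^ (N - Suc k) = (z * r powi (- (2 * int k + 1))) * (1 + r ^ (2 * k + 1) / z)"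
      using z by (simp add: algebra_simps)
  qed simp
  also have "\<dots> = (\<Prod>k<N. z * r powi (- (2 * int k + 1))) * (\<Prod>k<N. 1 + r ^ (2 * k + 1) / z)"
    by (rule prod.distrib)
  \<comment> \<open>The first N odd numbers add up to N^2.\<close>
  also have "(\<Prod>k<N. z * r powi (- (2 * int k + 1))) = z powi (int N) * r powi (- (int N)\<^sup>2)"
  proof (induction N)
    case (Suc N)
    have "r powi (- (int N)\<^sup>2) * r powi (- (2 * int N + 1)) = r powi (- (int (Suc N))\<^sup>2)"
      using r by (simp add: power_int_add[symmetric] power2_eq_square algebra_simps)
    then have "z ^ Suc N * r powi (- (int (Suc N))\<^sup>2) = (z ^ N * r powi (- (int N)\<^sup>2)) * (z * r powi (- (2 * int N + 1)))"
      by simp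
    then show ?case by (simp only: prod.lessThan_Suc Suc power_int_of_nat)
  qed simp
  also have "(\<Prod>k<N. 1 + w * (r\<^sup>2) ^ (N + k)) = (\<Prod>k<N. 1 + z * r ^ (2 * k + 1))"
  proof (intro prod.cong refl)
    fix k
    have "2 * int (N + k) + 1 - 2 * int N = int (2 * k + 1)" by simp
    then show "1 + w * (r\<^sup>2) ^ (N + k) = 1 + z * r ^ (2 * k + 1)"
      by (simp only: w power_int_of_nat)
  qed
  finally have L: "(\<Prod>k<2*N. 1 + w * (r\<^sup>2) ^ k) = z powi (int N) * r powi (- (int N)\<^sup>2) *
      (\<Prod>k<N. (1 + z * r ^ (2 * k + 1)) * (1 + r ^ (2 * k + 1) / z))"
    by (simp only: prod.distrib ac_simps)
  have "(\<Prod>k<2*N. 1 + w * (r\<^sup>2) ^ k) = (\<Sum>j\<le>2*N. (r\<^sup>2) ^ (j * (j - 1) div 2) * qbinom (r\<^sup>2) (2*N) j * w ^ j)"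
    by (rule qbinomial_theorem[OF p])
  also have "\<dots> = (\<Sum>j\<le>2*N. z powi (int N) * r powi (- (int N)\<^sup>2) *
      (z powi (int j - int N) * r ^ nat ((int j - int N)\<^sup>2) * qbinom (r\<^sup>2) (2*N) j))"
  proof (rule sum.cong)
    fix j
    have "int (2 * (j * (j - 1) div 2)) = int j * int j - int j"
      by (cases j) (auto simp: algebra_simps)
    moreover have "(r\<^sup>2) ^ (j * (j - 1) div 2) = r powi (int (2 * (j * (j - 1) div 2)))"
      by (simp only: power_int_of_nat power_mult)
    ultimately have 1: "(r\<^sup>2) ^ (j * (j - 1) div 2) = r powi (int j * int j - int j)"
      by simp
    have 2: "w ^ j = z powi (int j) * r powi ((1 - 2 * int N) * int j)"
      by (simp add: w_def power_mult_distrib power_int_mult)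
    \<comment> \<open>Completing the square, j^2 - 2Nj = (j - N)^2 - N^2, splits off the same
      monomial as on the product side.\<close>
    have 3: "r powi (int j * int j - int j) * r powi ((1 - 2 * int N) * int j)
       = r powi (- (int N)\<^sup>2) * r powi ((int j - int N)\<^sup>2)"
      using r by (simp add: power_int_add[symmetric] power2_eq_square algebra_simps)
    have 4: "r powi ((int j - int N)\<^sup>2) = r ^ nat ((int j - int N)\<^sup>2)"
      by (simp add: power_int_def)
    have 5: "z powi (int j) = z powi (int N) * z powi (int j - int N)"
      using z by (subst power_int_add[symmetric]) auto
    have "(r\<^sup>2) ^ (j * (j - 1) div 2) * qbinom (r\<^sup>2) (2*N) j * w ^ j =
       qbinom (r\<^sup>2) (2*N) j * z powi (int j) * (r powi (int j * int j - int j) * r powi ((1 - 2 * int N) * int j))"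
      unfolding 1 2 by (simp only: ac_simps)
    also have "\<dots> = z powi (int N) * r powi (- (int N)\<^sup>2) *
      (z powi (int j - int N) * r ^ nat ((int j - int N)\<^sup>2) * qbinom (r\<^sup>2) (2*N) j)"
      unfolding 3 4 5 by (simp only: ac_simps)
    finally show "(r\<^sup>2) ^ (j * (j - 1) div 2) * qbinom (r\<^sup>2) (2*N) j * w ^ j = z powi (int N) * r powi (- (int N)\<^sup>2) *
      (z powi (int j - int N) * r ^ nat ((int j - int N)\<^sup>2) * qbinom (r\<^sup>2) (2*N) j)" .
  qed simp
  also have "\<dots> = z powi (int N) * r powi (- (int N)\<^sup>2) *
     (\<Sum>j\<le>2*N. z powi (int j - int N) * r ^ nat ((int j - int N)\<^sup>2) * qbinom (r\<^sup>2) (2*N) j)"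
    by (simp only: sum_distrib_left)
  also have "(\<Sum>j\<le>2*N. z powi (int j - int N) * r ^ nat ((int j - int N)\<^sup>2) * qbinom (r\<^sup>2) (2*N) j)
     = (\<Sum>n\<in>{- int N..int N}. z powi n * r ^ nat (n\<^sup>2) * qbinom (r\<^sup>2) (2 * N) (nat (int N + n)))"
    by (rule sum.reindex_bij_witness[where i = "\<lambda>n. nat (int N + n)" and j = "\<lambda>j. int j - int N"]) auto
  finally show ?thesis using L r z by simp
qed

section \<open>Convergence, and the limit of the finite triple product\<close>

lemma summable_power_times_power_square:
  fixes c r :: real
  assumes "0 < r" "r < 1"
  shows "summable (\<lambda>n::nat. c ^ n * r ^ (n\<^sup>2))"
proof -
  have "(\<lambda>n. \<bar>c\<bar> * r ^ n) \<longlonglongrightarrow> \<bar>c\<bar> * 0"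
    using assms by (intro tendsto_intros LIMSEQ_power_zero) auto
  then have "eventually (\<lambda>n. \<bar>c\<bar> * r ^ n < 1/2) sequentially"
    by (rule order_tendstoD) simp
  then have "\<forall>\<^sub>F n in sequentially. norm (c ^ n * r ^ n\<^sup>2) \<le> (1/2) ^ n"
  proof eventually_elim
    case (elim n)
    have "norm (c ^ n * r ^ n\<^sup>2) = (\<bar>c\<bar> * r ^ n) ^ n"
      using assms by (simp add: abs_mult power_abs power_mult_distrib power2_eq_square power_mult)
    also have "\<dots> \<le> (1/2) ^ n"
      using elim assms by (intro power_mono) auto
    finally show ?case .
  qed
  then show ?thesis
    by (rule summable_comparison_test_ev) (simp add: summable_geometric)
qed

lemma theta_series_summable:
  fixes z r :: real
  assumes r: "0 < r" "r < 1"
  shows "(\<lambda>n::int. z powi n * r ^ nat (n\<^sup>2)) summable_on UNIV"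
proof -
  let ?f = "\<lambda>n::int. z powi n * r ^ nat (n\<^sup>2)"
  have nn: "(\<lambda>n::nat. c ^ n * r ^ (n\<^sup>2)) summable_on A" for c :: real and A
  proof -
    have "summable (\<lambda>n::nat. norm (c ^ n * r ^ (n\<^sup>2)))"
      using summable_power_times_power_square[OF r, of "\<bar>c\<bar>"] r by (simp add: abs_mult power_abs)
    then show ?thesis
      by (intro summable_on_subset_banach[OF norm_summable_imp_summable_on]) auto
  qed
  have 1: "?f summable_on (int ` UNIV)"
    by (subst summable_on_reindex) (use nn[of z UNIV] in \<open>auto simp: o_def nat_power_eq\<close>)
  have 2: "?f summable_on ((\<lambda>n. - int n) ` {0<..})"
    by (subst summable_on_reindex)
      (use nn[of "inverse z" "{0<..}"] in \<open>auto simp: o_def nat_power_eq inj_on_def power_int_minus power_inverse\<close>)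
  have "x \<in> range int \<union> (\<lambda>n. - int n) ` {0<..}" for x
    by (cases x rule: int_cases) (auto intro!: image_eqI[of _ _ "Suc _"])
  then have "range int \<union> (\<lambda>n. - int n) ` {0<..} = UNIV" by blast
  moreover have "range int \<inter> (\<lambda>n. - int n) ` {0<..} = {}" by auto
  ultimately show ?thesis using summable_on_Un_disjoint[OF 1 2] by simp
qed

lemma theta_factors_convergent:
  assumes "0 < p" "p < 1"
  shows "convergent_prod (\<lambda>k. (1 - x * p ^ k) * (1 - p ^ Suc k / x :: real))"
proof -
  have "convergent_prod (\<lambda>k. 1 + c * p ^ k)" for c :: real
    using assms by (intro abs_convergent_prod_imp_convergent_prod)
      (simp add: abs_convergent_prod_conv_summable abs_mult summable_mult summable_geometric power_abs)
  from convergent_prod_mult[OF this[of "- x"] this[of "- p / x"]] show ?thesis by (simp add: field_simps)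
qed

lemma theta_LIMSEQ:
  assumes "0 < p" "p < 1"
  shows "(\<lambda>n. \<Prod>k<n. (1 - x * p ^ k) * (1 - p ^ Suc k / x)) \<longlonglongrightarrow> theta x p"
  unfolding theta_def
  by (intro has_prod_imp_tendsto' convergent_prod_has_prod theta_factors_convergent assms)

text \<open>The sequence decreases to (p; p)_inf, which is positive. The lower bound serves to bound
  all Gaussian binomials uniformly.\<close>

lemma qfac_LIMSEQ:
  assumes "0 < p" "p < 1"
  obtains L where "qfac p \<longlonglongrightarrow> L" "L > 0" "\<And>n. L \<le> qfac p n"
proof -
  have c: "convergent_prod (\<lambda>k. 1 + (- p) * p ^ k)"
    using assms by (intro abs_convergent_prod_imp_convergent_prod)
      (simp add: abs_convergent_prod_conv_summable abs_mult summable_mult summable_geometric power_abs)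
  let ?L = "prodinf (\<lambda>k. 1 + (- p) * p ^ k)"
  have lim: "qfac p \<longlonglongrightarrow> ?L"
    using has_prod_imp_tendsto'[OF convergent_prod_has_prod[OF c]] by (simp add: qfac_def[abs_def])
  have "?L \<noteq> 0"
  proof (rule prodinf_nonzero[OF c])
    fix i show "1 + - p * p ^ i \<noteq> 0" using power_Suc_less_one[of p i] assms by simp
  qed
  have "qfac p (Suc n) \<le> qfac p n" for n
    unfolding qfac_Suc using qfac_pos[OF assms, of n] assms by (simp add: mult_left_le)
  then have dec: "decseq (qfac p)" by (rule decseq_SucI)
  have le: "?L \<le> qfac p n" for n using decseq_ge[OF dec lim] .
  have "?L \<ge> 0" using lim by (rule LIMSEQ_le_const) (use qfac_pos[OF assms] in \<open>auto intro: less_imp_le\<close>)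
  with \<open>?L \<noteq> 0\<close> have "?L > 0" by simp
  then show ?thesis using that lim le by blast
qed

text \<open>The limit of the finite form as N grows, where every Gaussian binomial tends to 1/L with
  L = (r^2; r^2)_inf. The constant \<open>C\<close> is this L; later arguments only need that it is
  nonzero and independent of \<open>x\<close>.\<close>

lemma theta_series_eq_theta:
  assumes r: "0 < r" "r < 1"
  obtains C where "C \<noteq> 0" "\<And>x. x \<noteq> 0 \<Longrightarrow> theta_series (- x / r) r = C * theta x (r\<^sup>2)"
proof -
  have p: "0 < r\<^sup>2" "r\<^sup>2 < 1" using r by (auto simp: power_less_one_iff)
  obtain L where L: "qfac (r\<^sup>2) \<longlonglongrightarrow> L" "L > 0" "\<And>n. L \<le> qfac (r\<^sup>2) n"
    using qfac_LIMSEQ[OF p] by blast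
  have qle1: "qfac (r\<^sup>2) n \<le> 1" for n
    unfolding qfac_def by (rule prod_le_1) (use p in \<open>auto simp: power_le_one simp del: power_Suc\<close>)
  \<comment> \<open>The coefficients are extended by 0 outside [-N, N], so that all finite sums
    become series over the same index set.\<close>
  define b where "b N n = (if n \<in> {- int N..int N} then qbinom (r\<^sup>2) (2 * N) (nat (int N + n)) else 0)" for N n
  have b_lim: "(\<lambda>N. b N n) \<longlonglongrightarrow> 1 / L" for n
  proof -
    have "(\<lambda>N. qfac (r\<^sup>2) (2 * N) / (qfac (r\<^sup>2) (nat (int N + n)) * qfac (r\<^sup>2) (nat (int N - n)))) \<longlonglongrightarrow> L / (L * L)"
    proof (intro tendsto_intros)
      show "(\<lambda>N. qfac (r\<^sup>2) (2 * N)) \<longlonglongrightarrow> L"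
        by (rule filterlim_compose[OF L(1)]) (simp add: filterlim_at_top_mult_tendsto_pos mult_nat_left_at_top)
      have *: "filterlim (\<lambda>N. nat (int N + c)) at_top sequentially" for c
        unfolding filterlim_at_top
      proof
        fix Z
        show "\<forall>\<^sub>F N in sequentially. Z \<le> nat (int N + c)"
          using eventually_ge_at_top[of "Z + nat \<bar>c\<bar>"] by eventually_elim linarith
      qed
      show "(\<lambda>N. qfac (r\<^sup>2) (nat (int N + n))) \<longlonglongrightarrow> L"
        by (rule filterlim_compose[OF L(1) *])
      show "(\<lambda>N. qfac (r\<^sup>2) (nat (int N - n))) \<longlonglongrightarrow> L"
        using filterlim_compose[OF L(1) *[of "- n"]] by simp
    qed (use L in auto)
    moreover have "\<forall>\<^sub>F N in sequentially. qfac (r\<^sup>2) (2 * N) / (qfac (r\<^sup>2) (nat (int N + n)) * qfac (r\<^sup>2) (nat (int N - n))) = b N n"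
      using eventually_ge_at_top[of "nat \<bar>n\<bar>"]
    proof eventually_elim
      case (elim N)
      then have "- int N \<le> n" "n \<le> int N" "nat (int N + n) \<le> 2 * N" "2 * N - nat (int N + n) = nat (int N - n)"
        by linarith+
      then show ?case by (simp add: b_def qbinom_def)
    qed
    ultimately show ?thesis using L(2) by (auto intro: Lim_transform_eventually)
  qed
  have b_bound: "\<bar>b N n\<bar> \<le> 1 / (L * L)" for N n
  proof -
    have "\<bar>qbinom (r\<^sup>2) m j\<bar> \<le> 1 / (L * L)" for m j
    proof (cases "j \<le> m")
      case True
      have "qfac (r\<^sup>2) m / (qfac (r\<^sup>2) j * qfac (r\<^sup>2) (m - j)) \<le> 1 / (L * L)"
        using L(2,3) qle1 by (intro frac_le mult_mono) (auto intro: less_imp_le qfac_pos p)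
      with True show ?thesis
        using qfac_pos[OF p] by (simp add: qbinom_def less_imp_le)
    qed (simp add: qbinom_def)
    then show ?thesis using L(2) by (auto simp: b_def)
  qed
  have key: "theta_series (- x / r) r = L * theta x (r\<^sup>2)" if x: "x \<noteq> 0" for x
  proof -
    define z where "z = - x / r"
    have z: "z \<noteq> 0" using x r by (simp add: z_def)
    define g where "g n = z powi n * r ^ nat (n\<^sup>2)" for n
    \<comment> \<open>Tannery's theorem is applied to series over the naturals, hence this
      enumeration of the integers.\<close>
    define e where "e = int_decode"
    have e: "bij e" unfolding e_def by (rule bij_int_decode)
    have summ: "g summable_on UNIV" unfolding g_def using theta_series_summable[OF r] .
    then have "(g has_sum theta_series z r) UNIV"
      unfolding theta_series_def g_def[symmetric] by (rule has_sum_infsum)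
    then have "((\<lambda>k. g (e k)) has_sum theta_series z r) UNIV"
      using has_sum_reindex_bij_betw[OF e, of g] by simp
    then have gs: "(\<lambda>k. g (e k)) sums theta_series z r" by (rule has_sum_imp_sums)
    have "(\<lambda>k. g (e k)) summable_on UNIV"
      using summ summable_on_reindex_bij_betw[OF e, of g] by simp
    from summable_on_imp_summable[OF summable_on_iff_abs_summable_on_real[THEN iffD1, OF this]]
    have gn: "summable (\<lambda>k. \<bar>g (e k)\<bar>)" by simp
    have fin: "(\<Prod>k<N. (1 - x * (r\<^sup>2) ^ k) * (1 - (r\<^sup>2) ^ Suc k / x)) = (\<Sum>k. g (e k) * b N (e k))" for N
    proof -
      have "1 + z * r ^ (2 * k + 1) = 1 - x * (r\<^sup>2) ^ k" for k
        using r by (simp add: z_def power_mult)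
      moreover have "1 + r ^ (2 * k + 1) / z = 1 - (r\<^sup>2) ^ Suc k / x" for k
        using r by (simp add: z_def power_mult power2_eq_square)
      ultimately have "(\<Prod>k<N. (1 - x * (r\<^sup>2) ^ k) * (1 - (r\<^sup>2) ^ Suc k / x)) =
         (\<Prod>k<N. (1 + z * r ^ (2 * k + 1)) * (1 + r ^ (2 * k + 1) / z))" by simp
      also have "\<dots> = (\<Sum>n\<in>{- int N..int N}. g n * b N n)"
        unfolding finite_jacobi_triple_product[OF r z] by (rule sum.cong) (auto simp: g_def b_def)
      finally have *: "\<dots> = (\<Prod>k<N. (1 - x * (r\<^sup>2) ^ k) * (1 - (r\<^sup>2) ^ Suc k / x))" ..
      have "((\<lambda>n. g n * b N n) has_sum (\<Sum>n\<in>{- int N..int N}. g n * b N n)) UNIV"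
        by (rule has_sum_finite_neutralI[of "{- int N..int N}"]) (auto simp: b_def)
      then have "((\<lambda>k. g (e k) * b N (e k)) has_sum (\<Sum>n\<in>{- int N..int N}. g n * b N n)) UNIV"
        using has_sum_reindex_bij_betw[OF e, of "\<lambda>n. g n * b N n"] by simp
      then show ?thesis unfolding * by (rule sums_unique[OF has_sum_imp_sums])
    qed
    \<comment> \<open>Limit and sum are interchanged with the dominating series |g| / L^2.\<close>
    have "(\<lambda>N. \<Sum>k. g (e k) * b N (e k)) \<longlonglongrightarrow> (\<Sum>k. g (e k) * (1 / L))"
    proof (rule tannerys_theorem[THEN conjunct2, THEN conjunct2])
      show "(\<lambda>N. g (e k) * b N (e k)) \<longlonglongrightarrow> g (e k) * (1 / L)" for k
        by (intro tendsto_intros b_lim)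
      show "\<forall>\<^sub>F (k, N) in sequentially \<times>\<^sub>F sequentially. norm (g (e k) * b N (e k)) \<le> \<bar>g (e k)\<bar> * (1 / (L * L))"
        using mult_left_mono[OF b_bound abs_ge_zero] by (intro always_eventually) (simp add: abs_mult)
      show "summable (\<lambda>k. \<bar>g (e k)\<bar> * (1 / (L * L)))" by (rule summable_mult2[OF gn])
    qed simp
    then have "theta x (r\<^sup>2) = (\<Sum>k. g (e k) * (1 / L))"
      using theta_LIMSEQ[OF p, of x] unfolding fin by (rule LIMSEQ_unique[rotated])
    also have "\<dots> = theta_series z r * (1 / L)"
      using sums_unique[OF sums_mult2[OF gs, of "1 / L"]] by simp
    finally show ?thesis using L(2) by (simp add: z_def)
  qed
  show ?thesis using that[of L] L(2) key by auto
qed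

subsection \<open>The Weierstrass relation\<close>

text \<open>Substitute \<open>(m, n) = (i + j, i - j)\<close> where \<open>m + n\<close> is even
  and \<open>(m, n) = (i + j, i - j + 1)\<close> where it is odd.\<close>

lemma theta_series_mult:
  assumes r: "0 < r" "r < 1" and nz: "a \<noteq> 0" "b \<noteq> 0"
  shows "theta_series a r * theta_series b r =
     theta_series (a * b) (r\<^sup>2) * theta_series (a / b) (r\<^sup>2) +
     b * r * theta_series (a * b * r\<^sup>2) (r\<^sup>2) * theta_series (a / (b * r\<^sup>2)) (r\<^sup>2)"
proof -
  define f where "f z s n = z powi n * s ^ nat (n\<^sup>2)" for z s :: real and n :: int
  have p: "0 < r\<^sup>2" "r\<^sup>2 < 1" using r by (auto simp: power_less_one_iff)
  \<comment> \<open>The double series converges absolutely, so it may be regrouped over any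
    partition of the lattice of pairs.\<close>
  have prod: "((\<lambda>(m, n). f z s m * f w s n) has_sum theta_series z s * theta_series w s) UNIV"
    if s: "0 < s" "s < 1" for z w s
  proof -
    have sm: "f z s summable_on UNIV" "f w s summable_on UNIV"
      unfolding f_def using theta_series_summable[OF s] by auto
    note ab = sm[THEN summable_on_iff_abs_summable_on_real[THEN iffD1]]
    have "(\<lambda>x. norm (case x of (m, n) \<Rightarrow> f z s m * f w s n)) summable_on UNIV \<times> UNIV"
    proof (rule summable_on_SigmaI)
      show "((\<lambda>n. norm (case (m, n) of (m, n) \<Rightarrow> f z s m * f w s n)) has_sum
          norm (f z s m) * (\<Sum>\<^sub>\<infinity>n. norm (f w s n))) UNIV" for m
        using has_sum_cmult_right[OF has_sum_infsum[OF ab(2)], of "norm (f z s m)"] by (simp add: abs_mult)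
      show "(\<lambda>m. norm (f z s m) * (\<Sum>\<^sub>\<infinity>n. norm (f w s n))) summable_on UNIV"
        by (rule summable_on_cmult_left[OF ab(1)])
    qed simp
    then have S: "(\<lambda>(m, n). f z s m * f w s n) summable_on UNIV \<times> UNIV"
      by (rule summable_on_iff_abs_summable_on_real[THEN iffD2])
    have "infsum (\<lambda>(m, n). f z s m * f w s n) (UNIV \<times> UNIV) = (\<Sum>\<^sub>\<infinity>m. \<Sum>\<^sub>\<infinity>n. f z s m * f w s n)"
      using infsum_Sigma'_banach[OF S] by simp
    also have "\<dots> = theta_series z s * theta_series w s"
      by (simp add: infsum_cmult_right' infsum_cmult_left' theta_series_def f_def)
    finally show ?thesis using has_sum_infsum[OF S] by simp
  qed
  let ?F = "\<lambda>(m, n). f a r m * f b r n"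
  let ?e = "\<lambda>(i, j). (i + j, i - j :: int)" and ?o = "\<lambda>(i, j). (i + j, i - j + 1 :: int)"
  have pw: "r powi (n\<^sup>2) = r ^ nat (n\<^sup>2)" for n :: int by (simp add: power_int_def)
  have pw2: "r powi (2 * n\<^sup>2) = (r\<^sup>2) ^ nat (n\<^sup>2)" for n :: int
    by (simp add: power_int_mult) (simp add: power_int_def)
  have pw3: "(r\<^sup>2) powi (n\<^sup>2) = (r\<^sup>2) ^ nat (n\<^sup>2)" for n :: int by (simp add: power_int_def)
  have ev: "?F (?e (i, j)) = f (a * b) (r\<^sup>2) i * f (a / b) (r\<^sup>2) j" for i j
  proof -
    have "?F (?e (i, j)) = (a powi (i + j) * b powi (i - j)) * (r powi ((i + j)\<^sup>2) * r powi ((i - j)\<^sup>2))"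
      by (simp add: f_def pw)
    also have "r powi ((i + j)\<^sup>2) * r powi ((i - j)\<^sup>2) = r powi (2 * i\<^sup>2) * r powi (2 * j\<^sup>2)"
      using r by (simp add: power_int_add[symmetric]) (simp add: power2_eq_square algebra_simps)
    also have "a powi (i + j) * b powi (i - j) = (a * b) powi i * (a / b) powi j"
      using nz by (simp add: power_int_add power_int_diff power_int_mult_distrib power_int_divide_distrib)
    finally show ?thesis by (simp add: f_def pw2)
  qed
  have od: "?F (?o (i, j)) = b * r * (f (a * b * r\<^sup>2) (r\<^sup>2) i * f (a / (b * r\<^sup>2)) (r\<^sup>2) j)" for i j
  proof -
    have "?F (?o (i, j)) = (a powi (i + j) * b powi (i - j + 1)) * (r powi ((i + j)\<^sup>2) * r powi ((i - j + 1)\<^sup>2))"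
      by (simp add: f_def pw)
    also have "r powi ((i + j)\<^sup>2) * r powi ((i - j + 1)\<^sup>2) = r * r powi (2 * i) / r powi (2 * j) * (r powi (2 * i\<^sup>2) * r powi (2 * j\<^sup>2))"
    proof -
      have "r powi ((i + j)\<^sup>2) * r powi ((i - j + 1)\<^sup>2) = r powi (1 + 2 * i - 2 * j + (2 * i\<^sup>2 + 2 * j\<^sup>2))"
        using r by (simp add: power_int_add[symmetric]) (simp add: power2_eq_square algebra_simps)
      also have "\<dots> = r powi (1 + 2 * i - 2 * j) * r powi (2 * i\<^sup>2 + 2 * j\<^sup>2)"
        using r by (intro power_int_add) auto
      also have "r powi (2 * i\<^sup>2 + 2 * j\<^sup>2) = r powi (2 * i\<^sup>2) * r powi (2 * j\<^sup>2)"
        using r by (intro power_int_add) auto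
      also have "r powi (1 + 2 * i - 2 * j) = r * r powi (2 * i) / r powi (2 * j)"
        using r by (simp add: power_int_diff power_int_add)
      finally show ?thesis .
    qed
    also have "a powi (i + j) * b powi (i - j + 1) = b * ((a * b) powi i * (a / b) powi j)"
      using nz by (simp add: power_int_add power_int_diff power_int_mult_distrib power_int_divide_distrib)
    finally show ?thesis
      using r nz by (simp add: f_def pw2 pw3 power_int_mult_distrib power_int_divide_distrib power_int_mult)
  qed
  have inj: "inj ?e" "inj ?o" by (auto simp: inj_def)
  have "?F \<circ> ?e = (\<lambda>(m, n). f (a * b) (r\<^sup>2) m * f (a / b) (r\<^sup>2) n)"
    using ev by (auto simp: fun_eq_iff)
  then have E: "(?F has_sum theta_series (a * b) (r\<^sup>2) * theta_series (a / b) (r\<^sup>2)) (range ?e)"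
    unfolding has_sum_reindex[OF inj(1)] using prod[OF p] by simp
  have "?F \<circ> ?o = (\<lambda>x. b * r * (case x of (m, n) \<Rightarrow> f (a * b * r\<^sup>2) (r\<^sup>2) m * f (a / (b * r\<^sup>2)) (r\<^sup>2) n))"
    using od by (auto simp: fun_eq_iff)
  then have O: "(?F has_sum b * r * (theta_series (a * b * r\<^sup>2) (r\<^sup>2) * theta_series (a / (b * r\<^sup>2)) (r\<^sup>2))) (range ?o)"
    unfolding has_sum_reindex[OF inj(2)] using has_sum_cmult_right[OF prod[OF p]] by simp
  have "range ?e \<inter> range ?o = {}"
  proof -
    have False if "?e x = ?o y" for x y
      using that by (cases x; cases y) (auto, presburger)
    then show ?thesis by blast
  qed
  moreover have "range ?e \<union> range ?o = UNIV"
  proof -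
    have "(m, n) \<in> range ?e \<union> range ?o" for m n :: int
    proof (cases "even (m + n)")
      case True
      then have "(m, n) = ?e ((m + n) div 2, (m - n) div 2)" by (auto, presburger+)
      then show ?thesis by blast
    next
      case False
      then have "(m, n) = ?o ((m + n - 1) div 2, (m - n + 1) div 2)" by (auto, presburger+)
      then show ?thesis by blast
    qed
    then show ?thesis by auto
  qed
  ultimately have "(?F has_sum theta_series (a * b) (r\<^sup>2) * theta_series (a / b) (r\<^sup>2) +
      b * r * (theta_series (a * b * r\<^sup>2) (r\<^sup>2) * theta_series (a / (b * r\<^sup>2)) (r\<^sup>2))) UNIV"
    using has_sum_Un_disjoint[OF E O] by simp
  from has_sum_unique[OF prod[OF r] this] show ?thesis by (simp add: mult.assoc)
qed

text \<open>By the triple product with r = sqrt p, both theta values are series at \<open>a\<close>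
  and \<open>b\<close>, and \<open>theta_series_mult\<close> applies. Each resulting series depends
  on one variable only, because a b = x^2 / p and a / b = y^2. The result is the 2 x 2 minor of the
  vectors (\<open>\<phi> x\<close>, x \<open>\<psi> x\<close>) and (\<open>\<phi> y\<close>, y
  \<open>\<psi> y\<close>).\<close>

lemma theta_mult_decomposition:
  assumes p: "0 < p" "p < 1"
  obtains \<phi> \<psi> where "\<And>x y. x \<noteq> 0 \<Longrightarrow> y \<noteq> 0 \<Longrightarrow>
    y * (theta (x * y) p * theta (x / y) p) = y * \<phi> x * \<psi> y - x * \<phi> y * \<psi> x"
proof -
  define r where "r = sqrt p"
  have r: "0 < r" "r < 1" "p = r\<^sup>2" using p by (auto simp: r_def)
  obtain C where C: "C \<noteq> 0" "\<And>x. x \<noteq> 0 \<Longrightarrow> theta_series (- x / r) r = C * theta x (r\<^sup>2)"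
    using theta_series_eq_theta[OF r(1,2)] by blast
  define \<phi> where "\<phi> x = theta_series (x\<^sup>2 / r\<^sup>2) (r\<^sup>2) / C" for x
  define \<psi> where "\<psi> x = theta_series (x\<^sup>2) (r\<^sup>2) / C" for x
  have "y * (theta (x * y) p * theta (x / y) p) = y * \<phi> x * \<psi> y - x * \<phi> y * \<psi> x"
    if "x \<noteq> 0" "y \<noteq> 0" for x y
  proof -
    define a b where "a = - (x * y) / r" and "b = - (x / y) / r"
    have ab: "a \<noteq> 0" "b \<noteq> 0" "a * b = x\<^sup>2 / r\<^sup>2" "a / b = y\<^sup>2" "b * r = - (x / y)"
       "a * b * r\<^sup>2 = x\<^sup>2" "a / (b * r\<^sup>2) = y\<^sup>2 / r\<^sup>2"
      using that r by (simp_all add: a_def b_def field_simps power2_eq_square)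
    have "(C * theta (x * y) p) * (C * theta (x / y) p) = theta_series a r * theta_series b r"
      using that C(2)[of "x * y"] C(2)[of "x / y"] by (simp add: a_def b_def r)
    also have "\<dots> = (C * \<phi> x) * (C * \<psi> y) - (x / y) * (C * \<psi> x) * (C * \<phi> y)"
      unfolding theta_series_mult[OF r(1,2) ab(1,2)] ab(3-7) using C(1) r(1) by (simp add: \<phi>_def \<psi>_def)
    finally have "C\<^sup>2 * (theta (x * y) p * theta (x / y) p) = C\<^sup>2 * (\<phi> x * \<psi> y - x / y * \<psi> x * \<phi> y)"
      by (simp add: power2_eq_square algebra_simps)
    then have "theta (x * y) p * theta (x / y) p = \<phi> x * \<psi> y - x / y * \<psi> x * \<phi> y"
      using C(1) by simp
    then show ?thesis using that by (simp add: field_simps)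
  qed
  then show ?thesis using that by blast
qed

text \<open>The Pluecker relation for the six minors formed from four vectors in the plane.\<close>

theorem theta_weierstrass:
  assumes p: "0 < p" "p < 1" and nz: "x \<noteq> 0" "y \<noteq> 0" "u \<noteq> 0" "v \<noteq> 0"
  shows "y * (theta (x * y) p * theta (x / y) p * (theta (u * v) p * theta (u / v) p))
       - u * (theta (x * u) p * theta (x / u) p * (theta (y * v) p * theta (y / v) p))
       + u * (theta (x * v) p * theta (x / v) p * (theta (y * u) p * theta (y / u) p)) = 0"
proof -
  obtain \<phi> \<psi> where dec: "\<And>x y. x \<noteq> 0 \<Longrightarrow> y \<noteq> 0 \<Longrightarrow>
    y * (theta (x * y) p * theta (x / y) p) = y * \<phi> x * \<psi> y - x * \<phi> y * \<psi> x"
    using theta_mult_decomposition[OF p] by blast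
  define P where "P x y = theta (x * y) p * theta (x / y) p" for x y
  have P: "y * P x y = y * \<phi> x * \<psi> y - x * \<phi> y * \<psi> x" if "x \<noteq> 0" "y \<noteq> 0" for x y
    using dec that by (simp add: P_def)
  \<comment> \<open>The extra factor \<open>v\<close> completes every term to a product of two
    minors.\<close>
  have "v * (y * (P x y * P u v) - u * (P x u * P y v) + u * (P x v * P y u))
     = (y * P x y) * (v * P u v) - (u * P x u) * (v * P y v) + (v * P x v) * (u * P y u)"
    by (simp add: algebra_simps)
  also have "\<dots> = 0"
    unfolding P[OF nz(1,2)] P[OF nz(3,4)] P[OF nz(1,3)] P[OF nz(2,4)] P[OF nz(1,4)] P[OF nz(2,3)]
    by (simp add: algebra_simps)
  finally show ?thesis using nz(4) by (simp add: P_def)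
qed

subsection \<open>Normalised theta functions\<close>

lemma theta_reflect:
  assumes "p \<noteq> 0" "x \<noteq> 0"
  shows "theta (p / x) p = theta x p"
  unfolding theta_def using assms by (simp add: field_simps)

text \<open>The partial products at \<open>x\<close> and 1/x differ only in their boundary factors;
  those involving \<open>p ^ n\<close> tend to 1.\<close>

lemma theta_inverse:
  assumes p: "0 < p" "p < 1" and x: "x \<noteq> 0"
  shows "theta (1 / x) p = - theta x p / x"
proof -
  define A where "A y n = (\<Prod>k<n. (1 - y * p ^ k) * (1 - p ^ Suc k / y))" for y n
  have step: "A (1 / x) n * (1 - p ^ n / x) * x = - A x n * (1 - x * p ^ n)" for n
  proof (induction n)
    case 0
    then show ?case using x by (simp add: A_def field_simps)
  next
    case (Suc n)
    have "A (1 / x) (Suc n) * (1 - p ^ Suc n / x) * x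
       = (A (1 / x) n * (1 - p ^ n / x) * x) * (1 - x * p ^ Suc n) * (1 - p ^ Suc n / x)"
      by (simp add: A_def)
    also have "\<dots> = - A x (Suc n) * (1 - x * p ^ Suc n)"
      unfolding Suc by (simp add: A_def)
    finally show ?case .
  qed
  have pn: "(\<lambda>n. p ^ n) \<longlonglongrightarrow> 0" using p by (intro LIMSEQ_power_zero) auto
  have lim: "A y \<longlonglongrightarrow> theta y p" for y
    using theta_LIMSEQ[OF p, of y] by (simp add: A_def[abs_def])
  have "(\<lambda>n. A (1 / x) n * (1 - p ^ n / x) * x) \<longlonglongrightarrow> theta (1 / x) p * (1 - 0 / x) * x"
    by (intro tendsto_intros lim pn x)
  moreover have "(\<lambda>n. - A x n * (1 - x * p ^ n)) \<longlonglongrightarrow> - theta x p * (1 - x * 0)"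
    by (intro tendsto_intros lim pn)
  ultimately have "theta (1 / x) p * x = - theta x p"
    unfolding step by (auto dest: LIMSEQ_unique)
  then show ?thesis using x by (simp add: field_simps)
qed

text \<open>Factor by factor, a difference of squares.\<close>

lemma theta_mult_minus:
  assumes p: "0 < p" "p < 1"
  shows "theta x p * theta (- x) p = theta (x\<^sup>2) (p\<^sup>2)"
proof -
  have p2: "0 < p\<^sup>2" "p\<^sup>2 < 1" using p by (auto simp: power_less_one_iff)
  have "(1 - x * p ^ k) * (1 - p ^ Suc k / x) * ((1 - (- x) * p ^ k) * (1 - p ^ Suc k / (- x)))
       = (1 - x\<^sup>2 * (p\<^sup>2) ^ k) * (1 - (p\<^sup>2) ^ Suc k / x\<^sup>2)" for k
  proof -
    have "(1 - y) * (1 - w) * ((1 + y) * (1 + w)) = (1 - y\<^sup>2) * (1 - w\<^sup>2)" for y w :: real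
      by (simp add: power2_eq_square algebra_simps)
    from this[of "x * p ^ k" "p ^ Suc k / x"]
    have "(1 - x * p ^ k) * (1 - p ^ Suc k / x) * ((1 - (- x) * p ^ k) * (1 - p ^ Suc k / (- x)))
      = (1 - (x * p ^ k)\<^sup>2) * (1 - (p ^ Suc k / x)\<^sup>2)"
      by simp
    then show ?thesis by (simp add: power_mult_distrib power_divide power_even_eq[symmetric] power_mult[symmetric] mult.commute)
  qed
  then have "(\<lambda>n. (\<Prod>k<n. (1 - x * p ^ k) * (1 - p ^ Suc k / x)) * (\<Prod>k<n. (1 - (- x) * p ^ k) * (1 - p ^ Suc k / (- x))))
      = (\<lambda>n. \<Prod>k<n. (1 - x\<^sup>2 * (p\<^sup>2) ^ k) * (1 - (p\<^sup>2) ^ Suc k / x\<^sup>2))"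
    by (simp only: prod.distrib[symmetric])
  with tendsto_mult[OF theta_LIMSEQ[OF p, of x] theta_LIMSEQ[OF p, of "- x"]] theta_LIMSEQ[OF p2, of "x\<^sup>2"]
  show ?thesis using LIMSEQ_unique by fastforce
qed

text \<open>The factors are sorted by the parity of the exponent of \<open>p\<close>: even exponents
  form \<open>theta x (p\<^sup>2)\<close>, odd ones \<open>theta (p / x) (p\<^sup>2)\<close>. Each
  step of the induction therefore compares two factors on the left with one on the right.\<close>

lemma theta_split:
  assumes p: "0 < p" "p < 1" and x: "x \<noteq> 0"
  shows "theta x p = theta x (p\<^sup>2) * theta (p / x) (p\<^sup>2)"
proof -
  have p2: "0 < p\<^sup>2" "p\<^sup>2 < 1" using p by (auto simp: power_less_one_iff)
  define A where "A y q n = (\<Prod>k<n. (1 - y * q ^ k) * (1 - q ^ Suc k / y))" for y q :: real and n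
  have lim: "A y q \<longlonglongrightarrow> theta y q" if "0 < q" "q < 1" for y q
    using theta_LIMSEQ[OF that, of y] by (simp add: A_def[abs_def])
  have "A x p (n * 2) = A x (p\<^sup>2) n * A (p / x) (p\<^sup>2) n" for n
  proof (induction n)
    case (Suc n)
    have n2: "(p\<^sup>2) ^ n = p ^ (n * 2)" by (simp add: power_mult[symmetric] mult.commute)
    have "A x p (Suc n * 2) = A x p (n * 2) * ((1 - x * p ^ (n * 2)) * (1 - p ^ Suc (n * 2) / x))
        * ((1 - x * p ^ Suc (n * 2)) * (1 - p ^ Suc (Suc (n * 2)) / x))"
      by (simp add: A_def)
    moreover have "A (p / x) (p\<^sup>2) (Suc n) = A (p / x) (p\<^sup>2) n * ((1 - p ^ Suc (n * 2) / x) * (1 - x * p ^ Suc (n * 2)))"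
    proof -
      have "p / x * (p\<^sup>2) ^ n = p ^ Suc (n * 2) / x"
        by (simp add: power_mult[symmetric] mult.commute)
      moreover have "(p\<^sup>2) ^ Suc n / (p / x) = x * p ^ Suc (n * 2)"
        using p x n2 by (simp add: power2_eq_square)
      ultimately show ?thesis by (simp only: A_def prod.lessThan_Suc)
    qed
    moreover have "A x (p\<^sup>2) (Suc n) = A x (p\<^sup>2) n * ((1 - x * p ^ (n * 2)) * (1 - p ^ Suc (Suc (n * 2)) / x))"
      using n2 by (simp add: A_def power2_eq_square)
    ultimately show ?case unfolding Suc by (simp only: ac_simps)
  qed (simp add: A_def)
  moreover have "(\<lambda>n. A x p (n * 2)) \<longlonglongrightarrow> theta x p"
    using LIMSEQ_linear[OF lim[OF p], of 2] by simp
  moreover have "(\<lambda>n. A x (p\<^sup>2) n * A (p / x) (p\<^sup>2) n) \<longlonglongrightarrow> theta x (p\<^sup>2) * theta (p / x) (p\<^sup>2)"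
    by (intro tendsto_intros lim p2)
  ultimately show ?thesis using LIMSEQ_unique by fastforce
qed

lemma theta_nonzero:
  assumes p: "0 < p" "p < 1" and "\<And>k. x * p ^ k \<noteq> 1" "\<And>k. p ^ Suc k \<noteq> x"
  shows "theta x p \<noteq> 0"
  unfolding theta_def
proof (rule prodinf_nonzero[OF theta_factors_convergent[OF p]])
  fix k
  have "p ^ Suc k / x \<noteq> 1" using assms(4)[of k] by (cases "x = 0") (auto simp: field_simps)
  then show "(1 - x * p ^ k) * (1 - p ^ Suc k / x) \<noteq> 0" using assms(3)[of k] by simp
qed

text \<open>The power of \<open>q\<close> makes all quasi-periodicity factors disappear; the exponent is
  \<open>B / 2\<close> times the second Bernoulli polynomial at \<open>a / B\<close>.\<close>

definition ntheta :: "real \<Rightarrow> nat \<Rightarrow> real \<Rightarrow> int \<Rightarrow> real" where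
  "ntheta q B s a = q powr (real_of_int a ^ 2 / (2 * real B) - real_of_int a / 2 + real B / 12)
     * theta (s * q powi a) (q ^ B)"

context
  fixes q :: real and B :: nat
  assumes q: "0 < q" "q < 1" and B: "B > 0"
begin

lemma power_base_bounds: "0 < q ^ B" "q ^ B < 1"
  using q B by (auto simp: power_less_one_iff)

text \<open>The factor q^(-a) from \<open>theta_inverse\<close> is absorbed, because the normalising
  exponents at \<open>a\<close> and \<open>- a\<close> differ by exactly \<open>a\<close>.\<close>

lemma ntheta_minus:
  assumes "s = 1 \<or> s = -1"
  shows "ntheta q B s (- a) = - s * ntheta q B s a"
proof -
  have "s * q powi (- a) = 1 / (s * q powi a)"
    using assms by (auto simp: power_int_minus field_simps)
  then have "theta (s * q powi (- a)) (q ^ B) = - theta (s * q powi a) (q ^ B) / (s * q powi a)"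
    using theta_inverse[OF power_base_bounds, of "s * q powi a"] assms q by auto
  also have "\<dots> = - s * q powr (- real_of_int a) * theta (s * q powi a) (q ^ B)"
    using assms q by (auto simp: powr_minus powr_real_of_int' field_simps)
  finally have T: "theta (s * q powi (- a)) (q ^ B) = - s * q powr (- real_of_int a) * theta (s * q powi a) (q ^ B)" .
  have "real_of_int a ^ 2 / (2 * real B) - real_of_int a / 2 + real B / 12
     = (real_of_int (- a) ^ 2 / (2 * real B) - real_of_int (- a) / 2 + real B / 12) + (- real_of_int a)"
    by simp
  then show ?thesis unfolding ntheta_def T by (simp only: powr_add) simp
qed

lemma ntheta_reflect: "ntheta q B 1 (int B - a) = ntheta q B 1 a"
proof -
  have "q powi (int B - a) = q ^ B / q powi a"
    using q by (simp add: power_int_diff)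
  then have "theta (1 * q powi (int B - a)) (q ^ B) = theta (1 * q powi a) (q ^ B)"
    using theta_reflect[of "q ^ B" "q powi a"] q by simp
  moreover have "real_of_int (int B - a) ^ 2 / (2 * real B) - real_of_int (int B - a) / 2
      = real_of_int a ^ 2 / (2 * real B) - real_of_int a / 2"
    using B by (simp add: field_simps power2_eq_square)
  ultimately show ?thesis by (simp only: ntheta_def)
qed

text \<open>For \<open>s = 1\<close>, a factor vanishes only if q^a is an integral power of
  \<open>q ^ B\<close>.\<close>

lemma ntheta_nonzero:
  assumes "\<not> int B dvd a"
  shows "ntheta q B 1 a \<noteq> 0"
proof -
  have ne: "q powi c \<noteq> 1" if "c \<noteq> 0" for c
  proof -
    have "q ^ n < 1" if "n > 0" for n using that q by (simp add: power_less_one_iff)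
    then have "q ^ n \<noteq> 1" if "n > 0" for n using that less_irrefl by metis
    then show ?thesis using that by (cases c rule: int_cases2) (auto simp: power_int_minus)
  qed
  have pw: "q powi a * (q ^ B) ^ k = q powi (a + int B * int k)" "(q ^ B) ^ k = q powi (int B * int k)" for k
    using q by (simp_all add: power_int_add power_int_mult)
  have "theta (1 * q powi a) (q ^ B) \<noteq> 0"
  proof (rule theta_nonzero[OF power_base_bounds])
    fix k
    have ndvd: "a \<noteq> int B * c" for c using assms by auto
    from ndvd[of "- int k"] have "a + int B * int k \<noteq> 0" by simp
    then show "1 * q powi a * (q ^ B) ^ k \<noteq> 1" using ne pw(1) by simp
    from ndvd[of "int (Suc k)"] have "int B * int (Suc k) - a \<noteq> 0" by simp
    then have "q powi (int B * int (Suc k) - a) \<noteq> 1" by (rule ne)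
    then show "(q ^ B) ^ Suc k \<noteq> 1 * q powi a"
      unfolding pw(2) using q by (simp add: power_int_diff)
  qed
  then show ?thesis using q by (simp add: ntheta_def)
qed

text \<open>The Weierstrass relation at the points s q^a, t q^b, u q^c, v q^d. The signs are their
  own inverses, so a product and a quotient of two points carry the same sign.\<close>

lemma ntheta_weierstrass:
  fixes a b c d :: int and s t u v :: real
  defines "P \<equiv> \<lambda>s a t b. ntheta q B (s * t) (a + b) * ntheta q B (s * t) (a - b)"
  assumes signs: "s = 1 \<or> s = -1" "t = 1 \<or> t = -1" "u = 1 \<or> u = -1" "v = 1 \<or> v = -1"
  shows "t * (P s a t b * P u c v d) - u * (P s a u c * P t b v d) + u * (P s a v d * P t b u c) = 0"
proof -
  define E where "E a = real_of_int a ^ 2 / (2 * real B) - real_of_int a / 2 + real B / 12" for a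
  define X where "X s a = s * q powi a" for s a
  define Q where "Q x y = theta (x * y) (q ^ B) * theta (x / y) (q ^ B)" for x y
  \<comment> \<open>In the normalising exponents at a + b and a - b, the mixed and linear terms in
    \<open>b\<close> cancel.\<close>
  have PQ: "P s a t b = q powr ((real_of_int a ^ 2 + real_of_int b ^ 2) / real B - real_of_int a + real B / 6) * Q (X s a) (X t b)"
    if "t = 1 \<or> t = -1" for s a t b
  proof -
    have 1: "X s a * X t b = s * t * q powi (a + b)" "X s a / X t b = s * t * q powi (a - b)"
      using that q by (auto simp: X_def power_int_add power_int_diff)
    have 2: "E (a + b) + E (a - b) = (real_of_int a ^ 2 + real_of_int b ^ 2) / real B - real_of_int a + real B / 6"
      using B by (simp add: E_def field_simps power2_eq_square)
    show ?thesis
      unfolding P_def ntheta_def E_def[symmetric] Q_def 1 2[symmetric] powr_add by (simp only: ac_simps)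
  qed
  \<comment> \<open>\<open>K\<close> is the exponent common to all three terms. What remains is q^b
    or q^c, matching the prefactors \<open>y\<close> and \<open>u\<close> of
    \<open>theta_weierstrass\<close>.\<close>
  define K where "K = (real_of_int a ^ 2 + real_of_int b ^ 2 + real_of_int c ^ 2 + real_of_int d ^ 2) / real B
     + real B / 3 - (real_of_int a + real_of_int b + real_of_int c)"
  have W: "X t b * (Q (X s a) (X t b) * Q (X u c) (X v d)) - X u c * (Q (X s a) (X u c) * Q (X t b) (X v d))
      + X u c * (Q (X s a) (X v d) * Q (X t b) (X u c)) = 0"
    unfolding Q_def by (rule theta_weierstrass[OF power_base_bounds]) (use signs q in \<open>auto simp: X_def\<close>)
  have X: "X s a = s * q powr (real_of_int a)" for s a
    using q by (simp add: X_def powr_real_of_int')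
  have comb: "t * ((x * Q1) * (y * Q2)) = k * ((t * w) * (Q1 * Q2))" if "x * y = k * w" for t x y k w Q1 Q2 :: real
  proof -
    have "t * ((x * Q1) * (y * Q2)) = t * (x * y) * (Q1 * Q2)" by (simp only: ac_simps)
    then show ?thesis unfolding that by (simp only: ac_simps)
  qed
  have "t * (P s a t b * P u c v d) = q powr K * (X t b * (Q (X s a) (X t b) * Q (X u c) (X v d)))"
  proof -
    have "q powr ((real_of_int a ^ 2 + real_of_int b ^ 2) / real B - real_of_int a + real B / 6) *
       q powr ((real_of_int c ^ 2 + real_of_int d ^ 2) / real B - real_of_int c + real B / 6) = q powr K * q powr (real_of_int b)"
      unfolding powr_add[symmetric] by (rule arg_cong[of _ _ "(powr) q"]) (simp add: K_def add_divide_distrib)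
    then show ?thesis unfolding PQ[OF signs(2)] PQ[OF signs(4)] X[of t b] by (rule comb)
  qed
  moreover have "u * (P s a u c * P t b v d) = q powr K * (X u c * (Q (X s a) (X u c) * Q (X t b) (X v d)))"
  proof -
    have "q powr ((real_of_int a ^ 2 + real_of_int c ^ 2) / real B - real_of_int a + real B / 6) *
       q powr ((real_of_int b ^ 2 + real_of_int d ^ 2) / real B - real_of_int b + real B / 6) = q powr K * q powr (real_of_int c)"
      unfolding powr_add[symmetric] by (rule arg_cong[of _ _ "(powr) q"]) (simp add: K_def add_divide_distrib)
    then show ?thesis unfolding PQ[OF signs(3)] PQ[OF signs(4)] X[of u c] by (rule comb)
  qed
  moreover have "u * (P s a v d * P t b u c) = q powr K * (X u c * (Q (X s a) (X v d) * Q (X t b) (X u c)))"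
  proof -
    have "q powr ((real_of_int a ^ 2 + real_of_int d ^ 2) / real B - real_of_int a + real B / 6) *
       q powr ((real_of_int b ^ 2 + real_of_int c ^ 2) / real B - real_of_int b + real B / 6) = q powr K * q powr (real_of_int c)"
      unfolding powr_add[symmetric] by (rule arg_cong[of _ _ "(powr) q"]) (simp add: K_def add_divide_distrib)
    then show ?thesis unfolding PQ[OF signs(3)] PQ[OF signs(4)] X[of u c] by (rule comb)
  qed
  ultimately show ?thesis using W by (simp only: right_diff_distrib[symmetric] distrib_left[symmetric] mult_zero_right)
qed

text \<open>The exponents agree by the duplication formula for the second Bernoulli
  polynomial.\<close>

lemma ntheta_split: "ntheta q B 1 a = ntheta q (2 * B) 1 a * ntheta q (2 * B) 1 (int B - a)"
proof -
  have "q powi (int B - a) = q ^ B / q powi a"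
    using q by (simp add: power_int_diff)
  then have T: "theta (1 * q powi a) (q ^ B) = theta (1 * q powi a) (q ^ (2 * B)) * theta (1 * q powi (int B - a)) (q ^ (2 * B))"
    using theta_split[OF power_base_bounds, of "q powi a"] q by (simp add: power_mult[symmetric] mult.commute)
  have E: "real_of_int a ^ 2 / (2 * real B) - real_of_int a / 2 + real B / 12
     = (real_of_int a ^ 2 / (2 * real (2 * B)) - real_of_int a / 2 + real (2 * B) / 12)
     + (real_of_int (int B - a) ^ 2 / (2 * real (2 * B)) - real_of_int (int B - a) / 2 + real (2 * B) / 12)"
    using B by (simp add: field_simps power2_eq_square)
  show ?thesis unfolding ntheta_def T E powr_add by (simp only: ac_simps)
qed

lemma ntheta_double: "ntheta q B 1 a * ntheta q B (-1) a = ntheta q (2 * B) 1 (2 * a)"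
proof -
  have "q powi (2 * a) = (q powi a)\<^sup>2"
    using power_int_mult[of q a 2] by (simp add: mult.commute)
  then have T: "theta (1 * q powi (2 * a)) (q ^ (2 * B)) = theta (1 * q powi a) (q ^ B) * theta (-1 * q powi a) (q ^ B)"
    using theta_mult_minus[OF power_base_bounds, of "q powi a"] by (simp add: power_mult[symmetric] mult.commute)
  have E: "real_of_int (2 * a) ^ 2 / (2 * real (2 * B)) - real_of_int (2 * a) / 2 + real (2 * B) / 12
     = (real_of_int a ^ 2 / (2 * real B) - real_of_int a / 2 + real B / 12) + (real_of_int a ^ 2 / (2 * real B) - real_of_int a / 2 + real B / 12)"
    using B by (simp add: field_simps power2_eq_square)
  show ?thesis unfolding ntheta_def T E powr_add by (simp only: ac_simps)
qed

end

subsection \<open>The theta identity of level 72\<close>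

text \<open>Oddness and reflection together yield the sign change under a shift by 72, which is then
  iterated.\<close>

lemma ntheta_72_shift:
  assumes q: "0 < q" "q < 1"
  shows "ntheta q 72 1 (a + 72 * j) = (if even j then 1 else -1) * ntheta q 72 1 a"
proof -
  have 1: "ntheta q 72 1 (a + 72) = - ntheta q 72 1 a" for a
    using ntheta_reflect[OF q, of 72 "- a"] ntheta_minus[OF q, of 72 1 a] by (simp add: add.commute)
  show ?thesis
  proof (induction j rule: int_induct[of _ 0])
    case base
    show ?case by simp
  next
    case (step1 i)
    then show ?case using 1[of "a + 72 * i"] by (simp add: algebra_simps)
  next
    case (step2 i)
    then show ?case using 1[of "a + 72 * (i - 1)"] by (auto simp: algebra_simps)
  qed
qed

context
  fixes q :: real and k :: int
  assumes q: "0 < q" "q < 1" and k: "coprime k 72"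
begin

text \<open>Oddness, reflection and non-vanishing survive multiplication of the arguments by a unit
  modulo 72, so one computation serves all six values of \<open>k\<close>.\<close>

abbreviation (input) scaled where "scaled a \<equiv> ntheta q 72 1 (k * a)"

lemma odd_of_coprime_72: "odd k"
  using k coprime_common_divisor[of k 72 2] by auto

lemma scaled_reflect: "scaled (72 - a) = scaled a"
proof -
  have "ntheta q 72 1 (k * (72 - a)) = ntheta q 72 1 (- (k * a) + 72 * k)" by (simp add: algebra_simps)
  then show ?thesis using odd_of_coprime_72 ntheta_minus[OF q, of 72 1 "k * a"] by (simp only: ntheta_72_shift[OF q]) simp
qed

lemma scaled_nonzero: "\<not> 72 dvd a \<Longrightarrow> scaled a \<noteq> 0"
  using k by (intro ntheta_nonzero[OF q]) (auto simp: coprime_commute coprime_dvd_mult_right_iff)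

text \<open>Both signs of the level 36 function are expressed through level 72. The sign
  \<open>e\<close> = (-1)^((k - 1)/2) arises because 36 k differs from 36 by 72 (k - 1)/2. It does
  not depend on \<open>a\<close>, so it factors out of a Weierstrass relation.\<close>

lemma ntheta_36_scaled:
  obtains e where "e \<noteq> 0"
    "\<And>a. ntheta q 36 1 (k * a) = e * (scaled a * scaled (36 - a))"
    "\<And>a. \<not> 36 dvd a \<Longrightarrow> ntheta q 36 (-1) (k * a) = scaled (2 * a) / (scaled a * scaled (36 - a)) * e"
proof -
  define j where "j = (k - 1) div 2"
  have j: "k = 2 * j + 1" using odd_of_coprime_72 by (simp add: j_def)
  define e :: real where "e = (if even j then 1 else -1)"
  have e: "e \<noteq> 0" "e * e = 1" by (auto simp: e_def)
  have u36: "ntheta q 72 1 (36 - k * a) = e * scaled (36 - a)" for a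
  proof -
    have "k * (36 - a) = (36 - k * a) + 72 * j" by (simp add: j algebra_simps)
    then have "scaled (36 - a) = e * ntheta q 72 1 (36 - k * a)"
      unfolding e_def by (simp only: ntheta_72_shift[OF q])
    then show ?thesis using e by (simp add: mult.assoc[symmetric])
  qed
  have 1: "ntheta q 36 1 (k * a) = e * (scaled a * scaled (36 - a))" for a
    using ntheta_split[OF q, of 36 "k * a"] by (simp add: u36)
  have 2: "ntheta q 36 (-1) (k * a) = scaled (2 * a) / (scaled a * scaled (36 - a)) * e" if "\<not> 36 dvd a" for a
  proof -
    have "\<not> 72 dvd a" "\<not> 72 dvd 36 - a" using that by presburger+
    then have nz: "scaled a \<noteq> 0" "scaled (36 - a) \<noteq> 0" using scaled_nonzero by blast+
    have "ntheta q 36 1 (k * a) * ntheta q 36 (-1) (k * a) = scaled (2 * a)"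
      using ntheta_double[OF q, of 36 "k * a"] by (simp add: algebra_simps)
    then have "e * (e * (scaled a * scaled (36 - a)) * ntheta q 36 (-1) (k * a)) = e * scaled (2 * a)"
      unfolding 1 by simp
    then have "(scaled a * scaled (36 - a)) * ntheta q 36 (-1) (k * a) = e * scaled (2 * a)"
      using e(2) by (simp add: mult.assoc[symmetric])
    then show ?thesis using nz by (simp add: field_simps)
  qed
  show ?thesis using that[OF e(1) 1 2] .
qed

text \<open>The reciprocal identity with denominators cleared and common factors removed. Up to
  \<open>e\<close>, \<open>tp a\<close> and \<open>tm a\<close> are the level 36 functions at q^(ka)
  and -q^(ka); three Weierstrass relations among them are combined linearly.\<close>

lemma scaled_theta_identity:
  "scaled 4 * scaled 11 * scaled 25 * scaled 30 * scaled 32 = scaled 5 * scaled 12 * scaled 16 * scaled 31 * scaled 34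
    + scaled 1 * scaled 4 * scaled 5 * scaled 9 * scaled 11 * scaled 12 * scaled 13 * scaled 14 * scaled 16 * scaled 23 * scaled 25 * scaled 27 * scaled 30 * scaled 31 * scaled 32 * scaled 34 * scaled 35"
proof -
  obtain e where e: "e \<noteq> 0" and plus: "\<And>a. ntheta q 36 1 (k * a) = e * (scaled a * scaled (36 - a))"
    and minus: "\<And>a. \<not> 36 dvd a \<Longrightarrow> ntheta q 36 (-1) (k * a) = scaled (2 * a) / (scaled a * scaled (36 - a)) * e"
    using ntheta_36_scaled by blast
  define U where "U a = scaled a" for a
  define tp where "tp a = U a * U (36 - a)" for a
  define tm where "tm a = U (2 * a) / (U a * U (36 - a))" for a
  have nz: "U a \<noteq> 0" if "0 < a" "a < 72" for a
    using scaled_nonzero[of a] zdvd_not_zless[of a 72] that by (auto simp: U_def)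
  have refl: "U a = U (72 - a)" for a unfolding U_def by (simp only: scaled_reflect)
  define t where "t s a = ntheta q 36 s (k * a)" for s a
  have t: "0 \<le> a \<Longrightarrow> t 1 a = e * tp a" "0 \<le> a \<Longrightarrow> \<not> 36 dvd a \<Longrightarrow> t (-1) a = e * tm a" for a
    unfolding t_def tp_def tm_def U_def by (rule plus, subst minus) (auto simp only: mult.commute)
  have t_minus: "t 1 (- a) = - t 1 a" "t (-1) (- a) = t (-1) a" for a
    unfolding t_def using ntheta_minus[OF q, of 36 1 "k * a"] ntheta_minus[OF q, of 36 "-1" "k * a"] by simp_all
  have W: "s2 * (t (s1 * s2) (a1 + a2) * t (s1 * s2) (a1 - a2) * (t (s3 * s4) (a3 + a4) * t (s3 * s4) (a3 - a4)))
     - s3 * (t (s1 * s3) (a1 + a3) * t (s1 * s3) (a1 - a3) * (t (s2 * s4) (a2 + a4) * t (s2 * s4) (a2 - a4)))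
     + s3 * (t (s1 * s4) (a1 + a4) * t (s1 * s4) (a1 - a4) * (t (s2 * s3) (a2 + a3) * t (s2 * s3) (a2 - a3))) = 0"
    if "s1 = 1 \<or> s1 = -1" "s2 = 1 \<or> s2 = -1" "s3 = 1 \<or> s3 = -1" "s4 = 1 \<or> s4 = -1"
    for s1 s2 s3 s4 a1 a2 a3 a4
    using ntheta_weierstrass[OF q, of 36 s1 s2 s3 s4 "k * a1" "k * a2" "k * a3" "k * a4"] that
    by (simp only: t_def distrib_left right_diff_distrib)
  \<comment> \<open>These values come from the numerators of \<open>tm 26\<close> and
    \<open>tm 25\<close>.\<close>
  have refl': "U 52 = U 20" "U 50 = U 22" using refl[of 52] refl[of 50] by simp_all
  have e4: "e * e * e * e \<noteq> 0" using e by simp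
  \<comment> \<open>Weierstrass at the points q^k, -q^(5k), -q^(14k), -q^(16k).\<close>
  have WA: "U 2 * U 8 * U 12 * U 13 * U 15 * U 21 * U 23 * U 34 - U 4 * U 11 * U 15 * U 21 * U 25 * U 26 * U 30 * U 32
      + U 4 * U 9 * U 13 * U 23 * U 27 * U 30 * U 32 * U 34 = 0"
  proof -
    have "e * e * e * e * (tm 6 * tm 4 * (tp 30 * tp 2) - tm 15 * tm 13 * (tp 21 * tp 11) + tm 17 * tm 15 * (tp 19 * tp 9)) = 0"
      using W[of 1 "-1" "-1" "-1" 1 5 14 16] by (simp add: t t_minus algebra_simps)
    then have "tm 6 * tm 4 * (tp 30 * tp 2) - tm 15 * tm 13 * (tp 21 * tp 11) + tm 17 * tm 15 * (tp 19 * tp 9) = 0"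
      using e4 by (simp only: mult_eq_0_iff) auto
    then have "U 12 * U 8 * U 2 * U 34 / (U 4 * U 32) - U 30 * U 26 * U 11 * U 25 / (U 13 * U 23) + U 34 * U 30 * U 9 * U 27 / (U 15 * U 21) = 0"
      using nz by (simp add: tp_def tm_def mult_ac)
    then show ?thesis using nz by (simp add: divide_simps) (simp add: algebra_simps)
  qed
  \<comment> \<open>Weierstrass at the points q^(2k), -q^(3k), q^(11k), q^(12k).\<close>
  have WB: "U 2 * U 8 * U 10 * U 13 * U 15 * U 21 * U 23 + U 5 * U 8 * U 13 * U 18 * U 23 * U 30 * U 31
      - U 5 * U 10 * U 15 * U 16 * U 21 * U 26 * U 31 = 0"
  proof -
    have "e * e * e * e * (tm 5 * tm 1 * (tp 23 * tp 1) + tp 13 * tp 9 * (tm 15 * tm 9) - tp 14 * tp 10 * (tm 14 * tm 8)) = 0"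
      using W[of 1 "-1" 1 1 2 3 11 12] by (simp add: t t_minus algebra_simps)
    then have "tm 5 * tm 1 * (tp 23 * tp 1) + tp 13 * tp 9 * (tm 15 * tm 9) - tp 14 * tp 10 * (tm 14 * tm 8) = 0"
      using e4 by (simp only: mult_eq_0_iff) auto
    then have "U 10 * U 2 * U 23 * U 13 / (U 5 * U 31) + U 13 * U 23 * U 30 * U 18 / (U 15 * U 21) - U 10 * U 26 * U 16 / U 8 = 0"
      using nz by (simp add: tp_def tm_def mult_ac)
    then show ?thesis using nz by (simp add: divide_simps) (simp add: algebra_simps)
  qed
  \<comment> \<open>Weierstrass at the points q^k, -q^(10k), -q^(11k), q^(15k); here the nonzero
    factor U 20 U 22 is common to all terms and is divided out.\<close>
  have WC: "- U 5 * U 8 * U 12 * U 18 * U 31 + U 4 * U 9 * U 10 * U 27 * U 32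
      - U 1 * U 4 * U 5 * U 9 * U 10 * U 11 * U 12 * U 14 * U 15 * U 16 * U 21 * U 25 * U 26 * U 27 * U 31 * U 32 * U 35 = 0"
  proof -
    have "e * e * e * e * (- tm 11 * tm 9 * (tm 26 * tm 4) + tm 12 * tm 10 * (tm 25 * tm 5) - tp 16 * tp 14 * (tp 21 * tp 1)) = 0"
      using W[of 1 "-1" "-1" 1 1 10 11 15] by (simp add: t t_minus algebra_simps)
    then have "- tm 11 * tm 9 * (tm 26 * tm 4) + tm 12 * tm 10 * (tm 25 * tm 5) - tp 16 * tp 14 * (tp 21 * tp 1) = 0"
      using e4 by (simp only: mult_eq_0_iff) auto
    then have "- (U 22 * U 18 * U 20 * U 8 / (U 11 * U 25 * U 9 * U 27 * U 26 * U 10 * U 4 * U 32)) +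
        U 20 * U 22 / (U 12 * U 26 * U 25 * U 11 * U 5 * U 31)
        - U 16 * U 20 * U 14 * U 22 * U 21 * U 15 * U 1 * U 35 = 0"
      using nz by (simp add: tp_def tm_def refl' mult_ac)
    then have "U 20 * U 22 * (- (U 18 * U 8 / (U 11 * U 25 * U 9 * U 27 * U 26 * U 10 * U 4 * U 32)) +
        1 / (U 12 * U 26 * U 25 * U 11 * U 5 * U 31)
        - U 16 * U 14 * U 21 * U 15 * U 1 * U 35) = 0"
      by (simp add: algebra_simps)
    then have "- (U 18 * U 8 / (U 11 * U 25 * U 9 * U 27 * U 26 * U 10 * U 4 * U 32)) +
        1 / (U 12 * U 26 * U 25 * U 11 * U 5 * U 31)
        - U 16 * U 14 * U 21 * U 15 * U 1 * U 35 = 0"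
      using nz by simp
    then show ?thesis using nz by (simp add: divide_simps) (simp add: algebra_simps)
  qed
  \<comment> \<open>The multipliers of the three relations make six of their nine terms cancel in
    pairs; the three left over share the factor \<open>c\<close>.\<close>
  define c where "c = U 10 * U 15 * U 21 * U 26"
  have "c * (U 4 * U 11 * U 25 * U 30 * U 32 - (U 5 * U 12 * U 16 * U 31 * U 34
    + U 1 * U 4 * U 5 * U 9 * U 11 * U 12 * U 13 * U 14 * U 16 * U 23 * U 25 * U 27 * U 30 * U 31 * U 32 * U 34 * U 35)) = 
    - U 10 * (U 2 * U 8 * U 12 * U 13 * U 15 * U 21 * U 23 * U 34 - U 4 * U 11 * U 15 * U 21 * U 25 * U 26 * U 30 * U 32
      + U 4 * U 9 * U 13 * U 23 * U 27 * U 30 * U 32 * U 34)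
    + U 12 * U 34 * (U 2 * U 8 * U 10 * U 13 * U 15 * U 21 * U 23 + U 5 * U 8 * U 13 * U 18 * U 23 * U 30 * U 31
      - U 5 * U 10 * U 15 * U 16 * U 21 * U 26 * U 31)
    + U 13 * U 23 * U 30 * U 34 * (- U 5 * U 8 * U 12 * U 18 * U 31 + U 4 * U 9 * U 10 * U 27 * U 32
      - U 1 * U 4 * U 5 * U 9 * U 10 * U 11 * U 12 * U 14 * U 15 * U 16 * U 21 * U 25 * U 26 * U 27 * U 31 * U 32 * U 35)"
    unfolding c_def by (simp add: algebra_simps)
  also have "\<dots> = 0" unfolding WA WB WC by simp
  finally show ?thesis using nz by (simp add: c_def U_def)
qed

text \<open>Seven residues occur in both lists and form \<open>c\<close>, the other five on each
  side form \<open>x\<close> and \<open>y\<close>. Dividing y = x + x y c by x y c gives the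
  claim.\<close>

lemma reciprocal_identity:
  "1 / (\<Prod>a\<leftarrow>[1, 5, 9, 12, 13, 14, 16, 23, 27, 31, 34, 35]. scaled a)
    = 1 / (\<Prod>a\<leftarrow>[1, 4, 9, 11, 13, 14, 23, 25, 27, 30, 32, 35]. scaled a) + 1"
proof -
  define U where "U a = scaled a" for a
  have nz: "U a \<noteq> 0" if "0 < a" "a < 72" for a
    using scaled_nonzero[of a] zdvd_not_zless[of a 72] that by (auto simp: U_def)
  have "1 / (x * c) = 1 / (y * c) + 1" if "y = x + x * y * c" "x \<noteq> 0" "y \<noteq> 0" "c \<noteq> 0" for x y c :: real
  proof -
    have "1 / (x * c) = y / (x * y * c)" "1 / (y * c) = x / (x * y * c)" "1 = x * y * c / (x * y * c)"
      using that by auto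
    then show ?thesis using that(1) by (metis add_divide_distrib)
  qed
  note rec = this
  define x y c where "x = U 5 * U 12 * U 16 * U 31 * U 34" and "y = U 4 * U 11 * U 25 * U 30 * U 32"
    and "c = U 1 * U 9 * U 13 * U 14 * U 23 * U 27 * U 35"
  have xyc: "x * y * c = U 1 * U 4 * U 5 * U 9 * U 11 * U 12 * U 13 * U 14 * U 16 * U 23 * U 25 * U 27 * U 30 * U 31 * U 32 * U 34 * U 35"
    unfolding x_def y_def c_def by (simp only: ac_simps)
  have "y = x + x * y * c"
    unfolding xyc unfolding x_def y_def U_def by (rule scaled_theta_identity)
  then have "1 / (x * c) = 1 / (y * c) + 1"
    by (rule rec) (use nz in \<open>auto simp: x_def y_def c_def\<close>)
  then show ?thesis
    unfolding U_def[symmetric] x_def y_def c_def by (simp add: mult_ac)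
qed

end

subsection \<open>Generating functions of partitions\<close>

text \<open>Vanishing is known only to the right of 0. After division by the power of the first
  nonzero coefficient, the limit from the right at 0 would be that coefficient.\<close>

lemma powser_zero_imp_coeff_zero:
  fixes c :: "nat \<Rightarrow> real"
  assumes "\<And>x. 0 < x \<Longrightarrow> x < 1 \<Longrightarrow> (\<lambda>n. c n * x ^ n) sums 0"
  shows "c n = 0"
proof (rule ccontr)
  assume "c n \<noteq> 0"
  define m where "m = (LEAST n. c n \<noteq> 0)"
  have m: "c m \<noteq> 0" unfolding m_def by (rule LeastI) fact
  have lt: "c i = 0" if "i < m" for i using that not_less_Least unfolding m_def by blast
  define d where "d i = c (i + m)" for i
  have d: "(\<lambda>i. d i * x ^ i) sums 0" if "0 < x" "x < 1" for x
  proof -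
    have "(\<lambda>i. c (i + m) * x ^ (i + m)) sums (0 - (\<Sum>i<m. c i * x ^ i))"
      using assms[OF that] by (rule sums_split_initial_segment)
    then have "(\<lambda>i. x ^ m * (d i * x ^ i)) sums 0"
      using lt by (simp add: d_def power_add mult_ac)
    then have "(\<lambda>i. (1 / x ^ m) * (x ^ m * (d i * x ^ i))) sums ((1 / x ^ m) * 0)"
      by (rule sums_mult)
    then show ?thesis using that by simp
  qed
  have "(\<lambda>i. d i * x ^ i) sums (\<Sum>i. d i * x ^ i)" if "norm x < 1/2" for x
    using powser_inside[OF sums_summable[OF d[of "1/2"]], of x] that by (simp add: summable_sums)
  then have "((\<lambda>x. \<Sum>i. d i * x ^ i) \<longlongrightarrow> d 0) (at 0)"
    by (intro powser_limit_0[of "1/2"]) auto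
  then have "((\<lambda>x. \<Sum>i. d i * x ^ i) \<longlongrightarrow> d 0) (at_right 0)"
    by (simp add: filterlim_at_split)
  moreover have "\<forall>\<^sub>F x in at_right 0. (\<Sum>i. d i * x ^ i) = 0"
    unfolding eventually_at_right_field using d by (auto intro!: exI[of _ 1] simp: sums_iff)
  ultimately have "((\<lambda>x::real. 0) \<longlongrightarrow> d 0) (at_right 0)"
    by (rule Lim_transform_eventually)
  then have "d 0 = 0" by (simp add: tendsto_const_iff)
  with m show False by (simp add: d_def)
qed

lemma coeff_eqI_of_powser_shift:
  fixes f g :: "nat \<Rightarrow> real"
  assumes "\<And>x. 0 < x \<Longrightarrow> x < 1 \<Longrightarrow> \<exists>F G. (\<lambda>n. f n * x ^ n) sums F \<and> (\<lambda>n. g n * x ^ n) sums G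
      \<and> F = x ^ d * G + c * x ^ e"
  shows "f n = (if d \<le> n then g (n - d) else 0) + (if n = e then c else 0)"
proof -
  have "(\<lambda>n. (f n - ((if d \<le> n then g (n - d) else 0) + (if n = e then c else 0))) * x ^ n) sums 0"
    if x: "0 < x" "x < 1" for x
  proof -
    obtain F G where FG: "(\<lambda>n. f n * x ^ n) sums F" "(\<lambda>n. g n * x ^ n) sums G" "F = x ^ d * G + c * x ^ e"
      using assms[OF x] by blast
    have "(\<lambda>n. (if d \<le> n then g (n - d) else 0) * x ^ n) sums (x ^ d * G)"
    proof (subst sums_iff_shift'[of _ d, symmetric])
      have "(\<lambda>n. x ^ d * (g n * x ^ n)) sums (x ^ d * G)" by (rule sums_mult[OF FG(2)])
      then show "(\<lambda>n. (if d \<le> n + d then g (n + d - d) else 0) * x ^ (n + d)) sums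
          (x ^ d * G - (\<Sum>n<d. (if d \<le> n then g (n - d) else 0) * x ^ n))"
        by (simp add: power_add mult_ac)
    qed
    moreover have "(\<lambda>n. (if n = e then c * x ^ n else 0)) sums (c * x ^ e)"
      by (rule sums_single)
    ultimately have "(\<lambda>n. f n * x ^ n - ((if d \<le> n then g (n - d) else 0) * x ^ n + (if n = e then c * x ^ n else 0)))
        sums (F - (x ^ d * G + c * x ^ e))"
      by (intro sums_diff sums_add FG(1))
    then have "(\<lambda>n. f n * x ^ n - ((if d \<le> n then g (n - d) else 0) * x ^ n + (if n = e then c * x ^ n else 0))) sums 0"
      by (simp add: FG(3))
    moreover have "f n * x ^ n - ((if d \<le> n then g (n - d) else 0) * x ^ n + (if n = e then c * x ^ n else 0))
      = (f n - ((if d \<le> n then g (n - d) else 0) + (if n = e then c else 0))) * x ^ n" for n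
      by (simp add: algebra_simps)
    ultimately show ?thesis by simp
  qed
  from powser_zero_imp_coeff_zero[OF this, of n] show ?thesis by simp
qed

section \<open>Partition counts: finite sets of parts, then infinite ones\<close>

lemma num_partitions_insert:
  assumes "0 \<notin> A" "a > 0" "a \<notin> A"
  shows "num_partitions (insert a A) n
    = num_partitions A n + (if a \<le> n then num_partitions (insert a A) (n - a) else 0)"
proof -
  \<comment> \<open>The partitions using the part \<open>a\<close> at least once: removing one copy
    matches them with the partitions of n - a.\<close>
  define X where "X = (if a \<le> n then add_mset a ` partitions_into (insert a A) (n - a) else {})"
  have "partitions_into (insert a A) n = partitions_into A n \<union> X"
  proof (intro equalityI subsetI)
    fix P assume P: "P \<in> partitions_into (insert a A) n"
    show "P \<in> partitions_into A n \<union> X"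
    proof (cases "a \<in># P")
      case True
      then obtain P' where P': "P = add_mset a P'" by (metis multi_member_split)
      with P have "a \<le> n" "P' \<in> partitions_into (insert a A) (n - a)"
        by (auto simp: partitions_into_def)
      with P' show ?thesis by (simp add: X_def)
    next
      case False
      with P show ?thesis by (auto simp: partitions_into_def)
    qed
  next
    fix P assume "P \<in> partitions_into A n \<union> X"
    then show "P \<in> partitions_into (insert a A) n"
      by (auto simp: X_def partitions_into_def split: if_splits)
  qed
  moreover have "a \<in># P" if "P \<in> X" for P using that by (auto simp: X_def split: if_splits)
  then have "partitions_into A n \<inter> X = {}"
    using assms(3) by (auto simp: partitions_into_def)
  moreover have "finite (partitions_into A n)" "finite X"
    using assms finite_partitions_into[of A] finite_partitions_into[of "insert a A"] by (simp_all add: X_def)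
  moreover have "card X = (if a \<le> n then num_partitions (insert a A) (n - a) else 0)"
    by (simp add: X_def num_partitions_def card_image inj_on_def)
  ultimately show ?thesis
    by (simp add: num_partitions_def card_Un_disjoint)
qed

text \<open>Parts are added one at a time. The recurrence bounds the partial sums, which gives
  convergence since all terms are nonnegative; in the limit it reads F = G + x^a F.\<close>

lemma num_partitions_finite_sums:
  fixes x :: real
  assumes x: "0 < x" "x < 1" and "finite A" "0 \<notin> A"
  shows "(\<lambda>n. num_partitions A n * x ^ n) sums (\<Prod>a\<in>A. 1 / (1 - x ^ a))"
  using assms(3,4)
proof (induction A rule: finite_induct)
  case empty
  have "partitions_into {} n = (if n = 0 then {{#}} else {})" for n
    by (auto simp: partitions_into_def)
  then have "(\<lambda>n. num_partitions {} n * x ^ n) = (\<lambda>n. if n = 0 then 1 * x ^ n else 0)"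
    by (auto simp: num_partitions_def)
  with sums_single[of 0 "\<lambda>n. 1 * x ^ n"] show ?case by simp
next
  case (insert a A)
  then have a: "a > 0" "0 \<notin> A" by auto
  have xa: "0 < x ^ a" "x ^ a < 1" using x a by (auto simp: power_less_one_iff)
  define f g where "f n = num_partitions (insert a A) n * x ^ n" and "g n = num_partitions A n * x ^ n" for n
  have fg: "f n = g n + (if a \<le> n then x ^ a * f (n - a) else 0)" for n
    unfolding f_def g_def num_partitions_insert[OF a(2,1) insert.hyps(2), of n]
    by (auto simp: algebra_simps power_add[symmetric])
  have nonneg: "f n \<ge> 0" "g n \<ge> 0" for n using x by (auto simp: f_def g_def)
  \<comment> \<open>For N < a the difference truncates to 0 and both sides vanish.\<close>
  have shift: "(\<Sum>n<N. if a \<le> n then x ^ a * f (n - a) else 0) = x ^ a * (\<Sum>n<N - a. f n)" for N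
    by (induction N) (auto simp: Suc_diff_le distrib_left not_le)
  have part: "(\<Sum>n<N. f n) = (\<Sum>n<N. g n) + x ^ a * (\<Sum>n<N - a. f n)" for N
    unfolding shift[symmetric] sum.distrib[symmetric] by (intro sum.cong refl fg)
  define G where "G = (\<Prod>a\<in>A. 1 / (1 - x ^ a))"
  have G: "g sums G" using insert.IH a(2) by (simp add: g_def[abs_def] G_def)
  have "(\<Sum>n<N. f n) \<le> G / (1 - x ^ a)" for N
  proof -
    have "(\<Sum>n<N. g n) \<le> G" using G nonneg(2) by (metis sums_iff sum_le_suminf finite_lessThan)
    moreover have "(\<Sum>n<N - a. f n) \<le> (\<Sum>n<N. f n)" by (rule sum_mono2) (auto simp: nonneg)
    ultimately have "(\<Sum>n<N. f n) \<le> G + x ^ a * (\<Sum>n<N. f n)"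
      unfolding part[of N] using xa by (intro add_mono mult_left_mono) (auto simp: part[symmetric])
    then show ?thesis using xa by (simp add: field_simps)
  qed
  then have "summable f" by (intro bounded_imp_summable[of _ "G / (1 - x ^ a)"] nonneg) (metis lessThan_Suc_atMost)
  then obtain F where F: "f sums F" by (auto simp: summable_def)
  then have lim: "(\<lambda>N. \<Sum>n<N. f n) \<longlonglongrightarrow> F" by (simp add: sums_def)
  have "(\<lambda>N. \<Sum>n<N - a. f n) \<longlonglongrightarrow> F"
    by (rule LIMSEQ_offset[of _ a]) (simp add: lim)
  then have "(\<lambda>N. (\<Sum>n<N. g n) + x ^ a * (\<Sum>n<N - a. f n)) \<longlonglongrightarrow> G + x ^ a * F"
    using G by (intro tendsto_intros) (auto simp: sums_def)
  then have "F = G + x ^ a * F" using lim unfolding part[symmetric] by (rule LIMSEQ_unique[rotated])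
  then have "F = G * (1 / (1 - x ^ a))" using xa by (simp add: field_simps)
  with F insert.hyps show ?case by (simp add: f_def[abs_def] G_def mult.commute)
qed

lemma num_partitions_mono:
  assumes "A \<subseteq> B" "0 \<notin> B"
  shows "num_partitions A n \<le> num_partitions B n"
  unfolding num_partitions_def
  using assms by (intro card_mono finite_partitions_into) (auto simp: partitions_into_def)

lemma num_partitions_restrict:
  assumes "n < N"
  shows "num_partitions (S \<inter> {..<N}) n = num_partitions S n"
proof -
  have "x \<le> n" if "sum_mset P = n" "x \<in># P" for x and P :: "nat multiset"
    using that by (metis le_add1 multi_member_split sum_mset.add_mset)
  then have "partitions_into (S \<inter> {..<N}) n = partitions_into S n"
    using assms by (fastforce simp: partitions_into_def)
  then show ?thesis by (simp add: num_partitions_def)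
qed

text \<open>A squeeze: truncating \<open>S\<close> below M K gives finite products
  \<open>R K\<close> that increase to 1/D. They bound the partial sums of the full series from
  above, and its sum from below.\<close>

lemma num_partitions_sums:
  fixes x :: real
  assumes x: "0 < x" "x < 1" and S: "0 \<notin> S" and M: "M > 0"
    and lim: "(\<lambda>K. \<Prod>a\<in>S \<inter> {..<M * K}. 1 - x ^ a) \<longlonglongrightarrow> D" and D: "D \<noteq> 0"
  shows "(\<lambda>n. num_partitions S n * x ^ n) sums (1 / D)"
proof -
  define R where "R K = (\<Prod>a\<in>S \<inter> {..<M * K}. 1 / (1 - x ^ a))" for K
  have Rs: "(\<lambda>n. num_partitions (S \<inter> {..<M * K}) n * x ^ n) sums R K" for K
    unfolding R_def using S by (intro num_partitions_finite_sums[OF x]) auto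
  have "(\<lambda>K. 1 / (\<Prod>a\<in>S \<inter> {..<M * K}. 1 - x ^ a)) \<longlonglongrightarrow> 1 / D"
    by (intro tendsto_intros lim D)
  then have R: "R \<longlonglongrightarrow> 1 / D" by (simp add: R_def[abs_def] prod_dividef)
  have "R K \<le> R K'" if "K \<le> K'" for K K'
  proof -
    have "num_partitions (S \<inter> {..<M * K}) n \<le> num_partitions (S \<inter> {..<M * K'}) n" for n
      using that S by (intro num_partitions_mono) (auto intro: less_le_trans mult_le_mono2)
    then show ?thesis using x by (intro sums_le[OF _ Rs Rs]) (simp add: mult_right_mono)
  qed
  then have RD: "R K \<le> 1 / D" for K using R by (intro incseq_le) (auto simp: incseq_def)
  have "(\<Sum>n<N. num_partitions S n * x ^ n) \<le> 1 / D" for N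
  proof -
    \<comment> \<open>Hence dropping the parts from M N on leaves all coefficients below N
      unchanged.\<close>
    have "N \<le> M * N" using M by simp
    then have "(\<Sum>n<N. num_partitions S n * x ^ n) = (\<Sum>n<N. num_partitions (S \<inter> {..<M * N}) n * x ^ n)"
      by (intro sum.cong) (auto simp: num_partitions_restrict[OF less_le_trans])
    also have "\<dots> \<le> R N"
      using Rs[of N] x sum_le_suminf[of "\<lambda>n. num_partitions (S \<inter> {..<M * N}) n * x ^ n" "{..<N}"]
      by (simp add: sums_iff)
    finally show ?thesis using RD[of N] by simp
  qed
  note bound = this
  have "summable (\<lambda>n. num_partitions S n * x ^ n)"
    by (rule bounded_imp_summable[of _ "1 / D"]) (use x bound in \<open>auto simp: lessThan_Suc_atMost[symmetric] simp del: sum.lessThan_Suc\<close>)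
  then obtain F where F: "(\<lambda>n. num_partitions S n * x ^ n) sums F" by (auto simp: summable_def)
  have "F \<le> 1 / D" using F bound by (intro LIMSEQ_le_const2[of _ F]) (auto simp: sums_def)
  moreover have "R K \<le> F" for K
    using x S num_partitions_mono[of "S \<inter> {..<M * K}" S] by (intro sums_le[OF _ Rs F]) (simp add: mult_right_mono)
  then have "1 / D \<le> F" using R by (intro LIMSEQ_le_const2[of R]) auto
  ultimately show ?thesis using F by simp
qed

text \<open>Induction over blocks of length \<open>M\<close>: the block starting at M K contributes
  exactly the numbers M K + r and M K + M - r with r in \<open>R\<close>.\<close>

lemma pm_residues_prod:
  fixes q :: real and M :: nat
  assumes q: "0 < q" and R: "finite R" "\<And>r. r \<in> R \<Longrightarrow> 0 < r \<and> 2 * r < int M"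
  shows "(\<Prod>a\<in>pm_residues R (int M) \<inter> {..<M * K}. 1 - q ^ a)
     = (\<Prod>r\<in>R. \<Prod>k<K. (1 - q powi r * (q ^ M) ^ k) * (1 - (q ^ M) ^ Suc k / q powi r))"
proof (induction K)
  case 0
  show ?case by simp
next
  case (Suc K)
  define S where "S = pm_residues R (int M)"
  define f g where "f r = M * K + nat r" and "g r = M * K + (M - nat r)" for r
  have mem: "M * K + m \<in> S \<longleftrightarrow> (\<exists>r\<in>R. m = nat r \<or> m = M - nat r)" if "m < M" for m
  proof -
    have "[int (M * K + m) = r] (mod int M) \<longleftrightarrow> m = nat r" "[int (M * K + m) = - r] (mod int M) \<longleftrightarrow> m = M - nat r"
      if "r \<in> R" for r
    proof -
      have r: "0 < r" "2 * r < int M" using R(2)[OF that] by auto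
      have 1: "int (M * K + m) mod int M = int m" using \<open>m < M\<close> by simp
      have 2: "r mod int M = r" "- r mod int M = int M - r" using r by (auto simp: zmod_zminus1_eq_if)
      show "[int (M * K + m) = r] (mod int M) \<longleftrightarrow> m = nat r" "[int (M * K + m) = - r] (mod int M) \<longleftrightarrow> m = M - nat r"
        unfolding cong_def 1 2 using r \<open>m < M\<close> by linarith+
    qed
    moreover have "m > 0" if "r \<in> R" "m = nat r \<or> m = M - nat r" for r using R(2)[OF that(1)] that(2) by auto
    ultimately show ?thesis unfolding S_def pm_residues_def by fastforce
  qed
  \<comment> \<open>The bound 2 r < M keeps the residues r and M - r' apart, so no number in the
    block is counted twice.\<close>
  have bnd: "nat r < M" "M - nat r < M" "nat r \<noteq> M - nat r'" if "r \<in> R" "r' \<in> R" for r r'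
    using R(2)[OF that(1)] R(2)[OF that(2)] by linarith+
  have "S \<inter> {M * K..<M * Suc K} = f ` R \<union> g ` R"
  proof (intro equalityI subsetI)
    fix n assume n: "n \<in> S \<inter> {M * K..<M * Suc K}"
    define m where "m = n - M * K"
    have m: "n = M * K + m" "m < M" using n by (auto simp: m_def)
    with n mem show "n \<in> f ` R \<union> g ` R" by (auto simp: f_def g_def)
  next
    fix n assume "n \<in> f ` R \<union> g ` R"
    then show "n \<in> S \<inter> {M * K..<M * Suc K}" using mem bnd by (auto simp: f_def g_def)
  qed
  moreover have "S \<inter> {..<M * Suc K} = (S \<inter> {..<M * K}) \<union> (S \<inter> {M * K..<M * Suc K})"
    by (auto simp: not_less)
  ultimately have split: "S \<inter> {..<M * Suc K} = (S \<inter> {..<M * K}) \<union> (f ` R \<union> g ` R)" by simp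
  have "(S \<inter> {..<M * K}) \<inter> (f ` R \<union> g ` R) = {}" by (auto simp: f_def g_def)
  moreover have "f ` R \<inter> g ` R = {}" using bnd by (auto simp: f_def g_def)
  ultimately have "(\<Prod>a\<in>S \<inter> {..<M * Suc K}. 1 - q ^ a)
     = (\<Prod>a\<in>S \<inter> {..<M * K}. 1 - q ^ a) * ((\<Prod>a\<in>f ` R. 1 - q ^ a) * (\<Prod>a\<in>g ` R. 1 - q ^ a))"
    unfolding split using R(1) by (subst prod.union_disjoint) (auto simp: prod.union_disjoint)
  also have "(\<Prod>a\<in>f ` R. 1 - q ^ a) = (\<Prod>r\<in>R. 1 - q powi r * (q ^ M) ^ K)"
  proof (subst prod.reindex)
    show "inj_on f R"
    proof
      fix x y assume "x \<in> R" "y \<in> R" "f x = f y"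
      then show "x = y" using R(2)[of x] R(2)[of y] unfolding f_def by linarith
    qed
    have "q ^ f r = q powi r * (q ^ M) ^ K" if "r \<in> R" for r
      using R(2)[OF that] by (simp add: f_def power_add power_mult power_int_def)
    then show "prod ((\<lambda>a. 1 - q ^ a) \<circ> f) R = (\<Prod>r\<in>R. 1 - q powi r * (q ^ M) ^ K)" by (intro prod.cong) auto
  qed
  also have "(\<Prod>a\<in>g ` R. 1 - q ^ a) = (\<Prod>r\<in>R. 1 - (q ^ M) ^ Suc K / q powi r)"
  proof (subst prod.reindex)
    show "inj_on g R"
    proof
      fix x y assume "x \<in> R" "y \<in> R" "g x = g y"
      then show "x = y" using R(2)[of x] R(2)[of y] unfolding g_def by linarith
    qed
    have "q ^ g r = (q ^ M) ^ Suc K / q powi r" if "r \<in> R" for r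
    proof -
      have "g r + nat r = M * Suc K" using bnd[OF that that] by (simp add: g_def)
      then have "q ^ g r * q ^ nat r = (q ^ M) ^ Suc K" by (simp only: power_add[symmetric] power_mult[symmetric])
      then show ?thesis using q R(2)[OF that] by (simp add: power_int_def field_simps)
    qed
    then show "prod ((\<lambda>a. 1 - q ^ a) \<circ> g) R = (\<Prod>r\<in>R. 1 - (q ^ M) ^ Suc K / q powi r)" by (intro prod.cong) auto
  qed
  finally show ?case unfolding Suc[folded S_def] S_def[symmetric] by (simp only: prod.lessThan_Suc prod.distrib ac_simps)
qed

lemma num_partitions_pm_residues_sums:
  fixes q :: real and M :: nat
  assumes q: "0 < q" "q < 1" and M: "M > 0" and R: "finite R" "\<And>r. r \<in> R \<Longrightarrow> 0 < r \<and> 2 * r < int M"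
  shows "(\<lambda>n. num_partitions (pm_residues R (int M)) n * q ^ n) sums (1 / (\<Prod>r\<in>R. theta (q powi r) (q ^ M)))"
proof (rule num_partitions_sums[OF q zero_notin_pm_residues M])
  have p: "0 < q ^ M" "q ^ M < 1" using q M by (auto simp: power_less_one_iff)
  show "(\<lambda>K. \<Prod>a\<in>pm_residues R (int M) \<inter> {..<M * K}. 1 - q ^ a) \<longlonglongrightarrow> (\<Prod>r\<in>R. theta (q powi r) (q ^ M))"
  proof -
    have "(\<Prod>a\<in>pm_residues R (int M) \<inter> {..<M * K}. 1 - q ^ a)
      = (\<Prod>r\<in>R. \<Prod>k<K. (1 - q powi r * (q ^ M) ^ k) * (1 - (q ^ M) ^ Suc k / q powi r))" for K
      by (rule pm_residues_prod[OF q(1) R])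
    then show ?thesis by (simp only:) (intro tendsto_prod theta_LIMSEQ[OF p])
  qed
  have "theta (q powi r) (q ^ M) \<noteq> 0" if "r \<in> R" for r
  proof -
    have "\<not> int M dvd r" using R(2)[OF that] by (auto dest: zdvd_imp_le)
    then show ?thesis using ntheta_nonzero[OF q M, of r] by (simp add: ntheta_def)
  qed
  then show "(\<Prod>r\<in>R. theta (q powi r) (q ^ M)) \<noteq> 0" using R(1) by simp
qed

section \<open>Removing the normalisation and reducing arguments modulo 72\<close>

lemma prod_list_ntheta:
  assumes "q > 0"
  shows "(\<Prod>a\<leftarrow>xs. ntheta q B 1 a)
    = q powr (\<Sum>a\<leftarrow>xs. real_of_int a ^ 2 / (2 * real B) - real_of_int a / 2 + real B / 12)
      * (\<Prod>a\<leftarrow>xs. theta (q powi a) (q ^ B))"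
proof (induction xs)
  case (Cons a xs)
  have "ntheta q B 1 a = q powr (real_of_int a ^ 2 / (2 * real B) - real_of_int a / 2 + real B / 12)
      * theta (q powi a) (q ^ B)"
    by (simp add: ntheta_def)
  then show ?case by (simp only: list.map prod_list.Cons sum_list.Cons Cons powr_add ac_simps)
qed (use assms in simp)

text \<open>Shifts and the reflection bring any argument into the range from 0 to 36; the parity of
  the number of shifts gives the sign.\<close>

lemma ntheta_72_reduce:
  assumes q: "0 < q" "q < 1"
  shows "ntheta q 72 1 b = (if even (b div 72) then 1 else -1) * ntheta q 72 1 (min (b mod 72) (72 - b mod 72))"
proof -
  have "ntheta q 72 1 b = ntheta q 72 1 (b mod 72 + 72 * (b div 72))" by simp
  also have "\<dots> = (if even (b div 72) then 1 else -1) * ntheta q 72 1 (b mod 72)"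
    by (rule ntheta_72_shift[OF q])
  also have "ntheta q 72 1 (b mod 72) = ntheta q 72 1 (min (b mod 72) (72 - b mod 72))"
    using ntheta_reflect[OF q, of 72 "b mod 72"] by (simp add: min_def)
  finally show ?thesis .
qed

subsection \<open>The six identities\<close>

abbreviation theta_prod :: "real \<Rightarrow> int list \<Rightarrow> real" where
  "theta_prod q xs \<equiv> \<Prod>a\<leftarrow>xs. theta (q powi a) (q ^ 72)"

abbreviation residue_72 :: "int \<Rightarrow> int" where
  "residue_72 b \<equiv> min (b mod 72) (72 - b mod 72)"

abbreviation residue_sign_72 :: "int \<Rightarrow> real" where
  "residue_sign_72 b \<equiv> (if even (b div 72) then 1 else -1)"

lemma prod_list_ntheta_72_reduce:
  assumes "0 < q" "q < 1"
  shows "(\<Prod>a\<leftarrow>xs. ntheta q 72 1 (k * a))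
    = (\<Prod>a\<leftarrow>xs. residue_sign_72 (k * a)) * (\<Prod>a\<leftarrow>map (\<lambda>a. residue_72 (k * a)) xs. ntheta q 72 1 a)"
proof (induction xs)
  case (Cons a xs)
  show ?case
    by (simp only: list.map prod_list.Cons Cons ntheta_72_reduce[OF assms, of "k * a"] mult.assoc mult.left_commute)
qed simp

text \<open>\<open>reciprocal_identity\<close> in terms of unnormalised theta products. The signs
  \<open>\<sigma>\<close>, \<open>\<tau>\<close> come from reducing the multiples of
  \<open>k\<close>, and the integers \<open>i\<close>, \<open>j\<close> are the total normalising
  exponents. For a numeral \<open>k\<close> all these data are found by evaluation.\<close>

lemma scaled_reciprocal_identity:
  fixes q \<sigma> \<tau> :: real and k i j :: int
  defines "xs \<equiv> [1, 5, 9, 12, 13, 14, 16, 23, 27, 31, 34, 35]" and "ys \<equiv> [1, 4, 9, 11, 13, 14, 23, 25, 27, 30, 32, 35]"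
  assumes q: "0 < q" "q < 1" and k: "coprime k 72"
    and S: "map (\<lambda>a. residue_72 (k * a)) xs = S" "(\<Prod>a\<leftarrow>xs. residue_sign_72 (k * a)) = \<sigma>"
      "(\<Sum>a\<leftarrow>S. real_of_int a ^ 2 / 144 - real_of_int a / 2 + 6) = real_of_int i"
    and T: "map (\<lambda>a. residue_72 (k * a)) ys = T" "(\<Prod>a\<leftarrow>ys. residue_sign_72 (k * a)) = \<tau>"
      "(\<Sum>a\<leftarrow>T. real_of_int a ^ 2 / 144 - real_of_int a / 2 + 6) = real_of_int j"
  shows "1 / theta_prod q S / (\<sigma> * q powi i) = 1 / theta_prod q T / (\<tau> * q powi j) + 1"
proof -
  have *: "(\<Prod>a\<leftarrow>zs. ntheta q 72 1 (k * a)) = u * q powi l * theta_prod q U"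
    if "map (\<lambda>a. residue_72 (k * a)) zs = U" "(\<Prod>a\<leftarrow>zs. residue_sign_72 (k * a)) = u"
      "(\<Sum>a\<leftarrow>U. real_of_int a ^ 2 / 144 - real_of_int a / 2 + 6) = real_of_int l" for zs U u l
    using that(3) q unfolding prod_list_ntheta_72_reduce[OF q] that(1,2) prod_list_ntheta[OF q(1)]
    by (simp add: powr_real_of_int')
  show ?thesis
    using reciprocal_identity[OF q k] unfolding xs_def[symmetric] ys_def[symmetric] *[OF S] *[OF T]
    by (simp add: mult_ac)
qed

text \<open>Comparison of coefficients. Distinct residues strictly between 0 and 36 make
  \<open>theta_prod\<close> the reciprocal of the generating function.\<close>

lemma num_partitions_eqI:
  assumes dist: "distinct xs" "distinct ys" and le: "set xs \<union> set ys \<subseteq> {0<..<36}"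
    and id: "\<And>q. 0 < q \<Longrightarrow> q < 1 \<Longrightarrow> 1 / theta_prod q xs = q ^ d * (1 / theta_prod q ys) + c * q ^ e"
  shows "real (num_partitions (pm_residues (set xs) 72) n)
    = (if d \<le> n then real (num_partitions (pm_residues (set ys) 72) (n - d)) else 0) + (if n = e then c else 0)"
proof (rule coeff_eqI_of_powser_shift)
  fix x :: real assume x: "0 < x" "x < 1"
  have "(\<lambda>n. num_partitions (pm_residues (set zs) (int 72)) n * x ^ n) sums (1 / theta_prod x zs)"
    if "zs = xs \<or> zs = ys" for zs
  proof -
    have "theta_prod x zs = (\<Prod>a\<in>set zs. theta (x powi a) (x ^ 72))"
      using dist that by (auto simp: prod.distinct_set_conv_list)
    moreover have "0 < r \<and> 2 * r < int 72" if "r \<in> set zs" for r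
      using le that \<open>zs = xs \<or> zs = ys\<close> by fastforce
    ultimately show ?thesis
      using num_partitions_pm_residues_sums[OF x, of 72 "set zs"] by simp
  qed
  from this[of xs] this[of ys]
  show "\<exists>F G. (\<lambda>n. num_partitions (pm_residues (set xs) 72) n * x ^ n) sums F \<and>
      (\<lambda>n. num_partitions (pm_residues (set ys) 72) n * x ^ n) sums G \<and> F = x ^ d * G + c * x ^ e"
    using id[OF x] by (intro exI[of _ "1 / theta_prod x xs"] exI[of _ "1 / theta_prod x ys"] conjI) simp_all
qed

text \<open>k = 1: the total exponents 0 and -1 produce the shift by 1.\<close>

lemma theta_prod_identity_1:
  fixes q :: real
  assumes q: "0 < q" "q < 1"
  shows "1 / theta_prod q [1, 5, 9, 12, 13, 14, 16, 23, 27, 31, 34, 35]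
    = q ^ 1 * (1 / theta_prod q [1, 4, 9, 11, 13, 14, 23, 25, 27, 30, 32, 35]) + 1 * q ^ 0"
proof -
  define X Y where "X = 1 / theta_prod q [1, 5, 9, 12, 13, 14, 16, 23, 27, 31, 34, 35]"
    and "Y = 1 / theta_prod q [1, 4, 9, 11, 13, 14, 23, 25, 27, 30, 32, 35]"
  have "X / (1 * q powi 0) = Y / (1 * q powi (-1)) + 1"
    unfolding X_def Y_def
  proof (rule scaled_reciprocal_identity[OF q, of 1])
    show "coprime (1 :: int) 72" by (simp add: coprime_iff_gcd_eq_1 gcd_code_int)
  qed simp_all
  then show ?thesis
    unfolding X_def[symmetric] Y_def[symmetric] using q by (simp add: power_int_minus field_simps)
qed

text \<open>k = 5, with the lists in the order in which multiplication by \<open>k\<close> produces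
  them. The first list of \<open>reciprocal_identity\<close> becomes the second one here. Both signs
  are -1 and both exponents 6, which leaves the monomial q^6.\<close>

lemma theta_prod_identity_5:
  fixes q :: real
  assumes q: "0 < q" "q < 1"
  shows "1 / theta_prod q [5, 20, 27, 17, 7, 2, 29, 19, 9, 6, 16, 31]
    = q ^ 0 * (1 / theta_prod q [5, 25, 27, 12, 7, 2, 8, 29, 9, 11, 26, 31]) + 1 * q ^ 6"
proof -
  define X Y where "X = 1 / theta_prod q [5, 20, 27, 17, 7, 2, 29, 19, 9, 6, 16, 31]"
    and "Y = 1 / theta_prod q [5, 25, 27, 12, 7, 2, 8, 29, 9, 11, 26, 31]"
  have "Y / (-1 * q powi 6) = X / (-1 * q powi 6) + 1"
    unfolding X_def Y_def
  proof (rule scaled_reciprocal_identity[OF q, of 5])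
    show "coprime (5 :: int) 72" by (simp add: coprime_iff_gcd_eq_1 gcd_code_int)
  qed simp_all
  then show ?thesis
    unfolding X_def[symmetric] Y_def[symmetric] using q by (simp add: power_int_minus field_simps)
qed

text \<open>k = 7: the lists change roles as for k = 5, both signs are -1, and the exponents -5 and
  0 produce the shift by 5.\<close>

lemma theta_prod_identity_7:
  fixes q :: real
  assumes q: "0 < q" "q < 1"
  shows "1 / theta_prod q [7, 28, 9, 5, 19, 26, 17, 31, 27, 6, 8, 29]
    = q ^ 5 * (1 / theta_prod q [7, 35, 9, 12, 19, 26, 32, 17, 27, 1, 22, 29]) + 1 * q ^ 0"
proof -
  define X Y where "X = 1 / theta_prod q [7, 28, 9, 5, 19, 26, 17, 31, 27, 6, 8, 29]"
    and "Y = 1 / theta_prod q [7, 35, 9, 12, 19, 26, 32, 17, 27, 1, 22, 29]"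
  have "Y / (-1 * q powi (-5)) = X / (-1 * q powi 0) + 1"
    unfolding X_def Y_def
  proof (rule scaled_reciprocal_identity[OF q, of 7])
    show "coprime (7 :: int) 72" by (simp add: coprime_iff_gcd_eq_1 gcd_code_int)
  qed simp_all
  then show ?thesis
    unfolding X_def[symmetric] Y_def[symmetric] using q by (simp add: power_int_minus field_simps)
qed

lemma theta_prod_identity_11:
  fixes q :: real
  assumes q: "0 < q" "q < 1"
  shows "1 / theta_prod q [11, 17, 27, 12, 1, 10, 32, 35, 9, 19, 14, 25]
    = q ^ 1 * (1 / theta_prod q [11, 28, 27, 23, 1, 10, 35, 13, 9, 30, 8, 25]) + 1 * q ^ 0"
proof -
  define X Y where "X = 1 / theta_prod q [11, 17, 27, 12, 1, 10, 32, 35, 9, 19, 14, 25]"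
    and "Y = 1 / theta_prod q [11, 28, 27, 23, 1, 10, 35, 13, 9, 30, 8, 25]"
  have "X / (1 * q powi 0) = Y / (1 * q powi (-1)) + 1"
    unfolding X_def Y_def
  proof (rule scaled_reciprocal_identity[OF q, of 11])
    show "coprime (11 :: int) 72" by (simp add: coprime_iff_gcd_eq_1 gcd_code_int)
  qed simp_all
  then show ?thesis
    unfolding X_def[symmetric] Y_def[symmetric] using q by (simp add: power_int_minus field_simps)
qed

text \<open>k = 13: the roles are those of k = 1, and the exponents 0 and -7 produce the shift by
  7.\<close>

lemma theta_prod_identity_13:
  fixes q :: real
  assumes q: "0 < q" "q < 1"
  shows "1 / theta_prod q [13, 7, 27, 12, 25, 34, 8, 11, 9, 29, 10, 23]
    = q ^ 7 * (1 / theta_prod q [13, 20, 27, 1, 25, 34, 11, 35, 9, 30, 16, 23]) + 1 * q ^ 0"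
proof -
  define X Y where "X = 1 / theta_prod q [13, 7, 27, 12, 25, 34, 8, 11, 9, 29, 10, 23]"
    and "Y = 1 / theta_prod q [13, 20, 27, 1, 25, 34, 11, 35, 9, 30, 16, 23]"
  have "X / (1 * q powi 0) = Y / (1 * q powi (-7)) + 1"
    unfolding X_def Y_def
  proof (rule scaled_reciprocal_identity[OF q, of 13])
    show "coprime (13 :: int) 72" by (simp add: coprime_iff_gcd_eq_1 gcd_code_int)
  qed simp_all
  then show ?thesis
    unfolding X_def[symmetric] Y_def[symmetric] using q by (simp add: power_int_minus field_simps)
qed

text \<open>k = 17: the lists change roles but both signs are +1, so the monomial q^2 appears with
  coefficient -1.\<close>

lemma theta_prod_identity_17:
  fixes q :: real
  assumes q: "0 < q" "q < 1"
  shows "1 / theta_prod q [17, 4, 9, 29, 5, 22, 31, 7, 27, 6, 32, 19]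
    = q ^ 0 * (1 / theta_prod q [17, 13, 9, 12, 5, 22, 16, 31, 27, 23, 2, 19]) + -1 * q ^ 2"
proof -
  define X Y where "X = 1 / theta_prod q [17, 4, 9, 29, 5, 22, 31, 7, 27, 6, 32, 19]"
    and "Y = 1 / theta_prod q [17, 13, 9, 12, 5, 22, 16, 31, 27, 23, 2, 19]"
  have "Y / (1 * q powi 2) = X / (1 * q powi 2) + 1"
    unfolding X_def Y_def
  proof (rule scaled_reciprocal_identity[OF q, of 17])
    show "coprime (17 :: int) 72" by (simp add: coprime_iff_gcd_eq_1 gcd_code_int)
  qed simp_all
  then show ?thesis
    unfolding X_def[symmetric] Y_def[symmetric] using q by (simp add: power_int_minus field_simps)
qed

theorem theorem18p3:
  shows "(let S = pm_residues {1, 5, 9, 12, 13, 14, 16, 23, 27, 31, 34, 35} 72;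
         T = pm_residues {1, 4, 9, 11, 13, 14, 23, 25, 27, 30, 32, 35} 72
     in \<forall>n\<ge>1. num_partitions S n = num_partitions T (n - 1)) \<and>
         (let S = pm_residues {2, 5, 6, 7, 9, 16, 17, 19, 20, 27, 29, 31} 72;
         T = pm_residues {2, 5, 7, 8, 9, 11, 12, 25, 26, 27, 29, 31} 72
     in \<forall>n. n \<noteq> 6 \<longrightarrow> num_partitions S n = num_partitions T n) \<and>
         (let S = pm_residues {5, 6, 7, 8, 9, 17, 19, 26, 27, 28, 29, 31} 72;
         T = pm_residues {1, 7, 9, 12, 17, 19, 22, 26, 27, 29, 32, 35} 72
     in \<forall>n\<ge>5. num_partitions S n = num_partitions T (n - 5)) \<and>
         (let S = pm_residues {1, 9, 10, 11, 12, 14, 17, 19, 25, 27, 32, 35} 72;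
         T = pm_residues {1, 8, 9, 10, 11, 13, 23, 25, 27, 28, 30, 35} 72
     in \<forall>n\<ge>1. num_partitions S n = num_partitions T (n - 1)) \<and>
         (let S = pm_residues {7, 8, 9, 10, 11, 12, 13, 23, 25, 27, 29, 34} 72;
         T = pm_residues {1, 9, 11, 13, 16, 20, 23, 25, 27, 30, 34, 35} 72
     in \<forall>n\<ge>7. num_partitions S n = num_partitions T (n - 7)) \<and>
         (let S = pm_residues {4, 5, 6, 7, 9, 17, 19, 22, 27, 29, 31, 32} 72;
         T = pm_residues {2, 5, 9, 12, 13, 16, 17, 19, 22, 23, 27, 31} 72
     in \<forall>n. n \<noteq> 2 \<longrightarrow> num_partitions S n = num_partitions T n)"
  unfolding Let_def
proof (intro conjI allI impI)
  \<comment> \<open>In each case the restriction on \<open>n\<close> excludes the exponent of the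
    exceptional monomial; \<open>insert_commute\<close> sorts the residues.\<close>
  fix n :: nat
  show "num_partitions (pm_residues {1, 5, 9, 12, 13, 14, 16, 23, 27, 31, 34, 35} 72) n
      = num_partitions (pm_residues {1, 4, 9, 11, 13, 14, 23, 25, 27, 30, 32, 35} 72) (n - 1)" if "1 \<le> n"
    using num_partitions_eqI[OF _ _ _ theta_prod_identity_1, of n] that by (simp add: insert_commute)
  show "num_partitions (pm_residues {2, 5, 6, 7, 9, 16, 17, 19, 20, 27, 29, 31} 72) n
      = num_partitions (pm_residues {2, 5, 7, 8, 9, 11, 12, 25, 26, 27, 29, 31} 72) n" if "n \<noteq> 6"
    using num_partitions_eqI[OF _ _ _ theta_prod_identity_5, of n] that by (simp add: insert_commute)
  show "num_partitions (pm_residues {5, 6, 7, 8, 9, 17, 19, 26, 27, 28, 29, 31} 72) n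
      = num_partitions (pm_residues {1, 7, 9, 12, 17, 19, 22, 26, 27, 29, 32, 35} 72) (n - 5)" if "5 \<le> n"
    using num_partitions_eqI[OF _ _ _ theta_prod_identity_7, of n] that by (simp add: insert_commute)
  show "num_partitions (pm_residues {1, 9, 10, 11, 12, 14, 17, 19, 25, 27, 32, 35} 72) n
      = num_partitions (pm_residues {1, 8, 9, 10, 11, 13, 23, 25, 27, 28, 30, 35} 72) (n - 1)" if "1 \<le> n"
    using num_partitions_eqI[OF _ _ _ theta_prod_identity_11, of n] that by (simp add: insert_commute)
  show "num_partitions (pm_residues {7, 8, 9, 10, 11, 12, 13, 23, 25, 27, 29, 34} 72) n
      = num_partitions (pm_residues {1, 9, 11, 13, 16, 20, 23, 25, 27, 30, 34, 35} 72) (n - 7)" if "7 \<le> n"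
    using num_partitions_eqI[OF _ _ _ theta_prod_identity_13, of n] that by (simp add: insert_commute)
  show "num_partitions (pm_residues {4, 5, 6, 7, 9, 17, 19, 22, 27, 29, 31, 32} 72) n
      = num_partitions (pm_residues {2, 5, 9, 12, 13, 16, 17, 19, 22, 23, 27, 31} 72) n" if "n \<noteq> 2"
    using num_partitions_eqI[OF _ _ _ theta_prod_identity_17, of n] that by (simp add: insert_commute)
qed

end
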